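(* There exists a universal constant $C>0$ such that the following holds. Let $A$ be the adjacency matrix of an inhomogeneous Erdős–Rényi random graph on $n$ vertices with edge probabilities $(p_{ij})$, let $d=\max_{i,j} n p_{ij}$, and let $\tau>0$. Then for every $r\ge 1$, $$\mathbb{P}\left\{\left\|\mathcal{L}(A_\tau)-\mathcal{L}(\mathbb{E}A_\tau)\right\|\ \ge\ C\,\frac{r^2}{\sqrt{\tau}}\left(1+\frac{d}{\tau}\right)^{1/2}\right\}\le e^{-r}.$$
   Context: Inhomogeneous Erdős–Rényi graph: given $p_{ij}=p_{ji}\in[0,1]$ for $i\neq j$ (and $p_{ii}=0$), the adjacency matrix $A$ is the random symmetric $n\times n$ matrix with zero diagonal whose entries $A_{ij}$, $i<j$, are independent Bernoulli variables with $\mathbb{P}(A_{ij}=1)=p_{ij}$. Regularization: $A_\tau:=A+\frac{\tau}{n}\bar 1\bar 1^{\top}$, where $\bar 1\in\mathbb{R}^n$ is the all-ones column vector; thus $\mathbb{E}A_\tau=\mathbb{E}A+\frac{\tau}{n}\bar 1\bar 1^{\top}$. Normalized Laplacian: for a symmetric matrix $M$ with nonnegative entries and positive row sums, $\mathcal{L}(M)=I-D^{-1/2}MD^{-1/2}$, where $D$ is the diagonal matrix with $D_{ii}=\sum_{j}M_{ij}$. In particular, for $A_\tau$ the diagonal matrix has entries $\sum_j A_{ij}+\tau$, and for $\mathbb{E}A_\tau$ it has entries $\sum_j p_{ij}+\tau$. $\|\cdot\|$ is the spectral norm. *)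

theory Defs
  imports "HOL-Probability.Probability" "Jordan_Normal_Form.Matrix"
begin

text \<open>Vertices are \<open>0, \<dots>, n - 1\<close>. Matrices are those of \<^theory>\<open>Jordan_Normal_Form.Matrix\<close>,
  whose dimension is a term, so that a constant can be uniform in \<open>n\<close>.\<close>

definition edge_probs :: "nat \<Rightarrow> (nat \<Rightarrow> nat \<Rightarrow> real) \<Rightarrow> bool" where
  "edge_probs n p \<longleftrightarrow>
     (\<forall>i<n. \<forall>j<n. 0 \<le> p i j \<and> p i j \<le> 1 \<and> p i j = p j i) \<and> (\<forall>i<n. p i i = 0)"

definition adjacency_mat :: "nat \<Rightarrow> (nat \<times> nat \<Rightarrow> bool) \<Rightarrow> real mat" where
  "adjacency_mat n x = Matrix.mat n n (\<lambda>(i, j).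
     if i < j then of_bool (x (i, j)) else if j < i then of_bool (x (j, i)) else 0)"

text \<open>The law of the adjacency matrix: the image of a product of Bernoulli measures indexed by
  the pairs \<open>i < j\<close>.\<close>

definition inhom_ER :: "nat \<Rightarrow> (nat \<Rightarrow> nat \<Rightarrow> real) \<Rightarrow> real mat pmf" where
  "inhom_ER n p = map_pmf (adjacency_mat n)
     (Pi_pmf {(i, j). i < j \<and> j < n} False (\<lambda>(i, j). bernoulli_pmf (p i j)))"

definition expectation_mat :: "nat \<Rightarrow> 'a pmf \<Rightarrow> ('a \<Rightarrow> real mat) \<Rightarrow> real mat" where
  "expectation_mat n P X =
     Matrix.mat n n (\<lambda>(i, j). measure_pmf.expectation P (\<lambda>\<omega>. X \<omega> $$ (i, j)))"

text \<open>The all-ones \<open>n \<times> n\<close> matrix is the outer product of the all-ones column vector with itself.\<close>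

definition regularize :: "nat \<Rightarrow> real \<Rightarrow> real mat \<Rightarrow> real mat" where
  "regularize n \<tau> A = A + (\<tau> / real n) \<cdot>\<^sub>m Matrix.mat n n (\<lambda>_. 1)"

definition row_sum :: "real mat \<Rightarrow> nat \<Rightarrow> real" where
  "row_sum M i = (\<Sum>j<dim_col M. M $$ (i, j))"

definition laplacian :: "real mat \<Rightarrow> real mat" where
  "laplacian M = (let n = dim_row M; D' = mat_diag n (\<lambda>i. row_sum M i powr (- 1 / 2))
     in 1\<^sub>m n - D' * M * D')"

definition vec_norm2 :: "real Matrix.vec \<Rightarrow> real" where
  "vec_norm2 v = sqrt (scalar_prod v v)"

text \<open>The unit ball, rather than the unit sphere, keeps the supremum over a nonempty set in
  dimension 0.\<close>

definition spectral_norm :: "real mat \<Rightarrow> real" where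
  "spectral_norm M =
     (SUP v \<in> {v \<in> carrier_vec (dim_col M). vec_norm2 v \<le> 1}. vec_norm2 (M *\<^sub>v v))"

definition max_density :: "nat \<Rightarrow> (nat \<Rightarrow> nat \<Rightarrow> real) \<Rightarrow> real" where
  "max_density n p = Max ((\<lambda>(i, j). real n * p i j) ` ({..<n} \<times> {..<n}))"

text \<open>Consistency with the defining properties of the model.\<close>

lemma finite_edge_slots: "finite {(i, j). i < j \<and> j < (n::nat)}"
  by (rule finite_subset[of _ "{..<n} \<times> {..<n}"]) auto

lemma inhom_ER_carrier:
  assumes "A \<in> set_pmf (inhom_ER n p)"
  shows "A \<in> carrier_mat n n"
  using assms by (auto simp: inhom_ER_def adjacency_mat_def)

lemma inhom_ER_symmetric:
  assumes "A \<in> set_pmf (inhom_ER n p)" "i < n" "j < n"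
  shows "A $$ (i, j) = A $$ (j, i)" and "A $$ (i, i) = 0"
  using assms by (auto simp: inhom_ER_def adjacency_mat_def)

lemma inhom_ER_entry:
  assumes "i < j" "j < n"
  shows "map_pmf (\<lambda>A. A $$ (i, j)) (inhom_ER n p) = map_pmf of_bool (bernoulli_pmf (p i j))"
proof -
  let ?S = "{(i, j). i < j \<and> j < n}"
  let ?P = "Pi_pmf ?S False (\<lambda>(i, j). bernoulli_pmf (p i j))"
  have "map_pmf (\<lambda>A. A $$ (i, j)) (inhom_ER n p) = map_pmf of_bool (map_pmf (\<lambda>x. x (i, j)) ?P)"
    using assms by (simp add: inhom_ER_def map_pmf_comp adjacency_mat_def)
  also have "map_pmf (\<lambda>x. x (i, j)) ?P = bernoulli_pmf (p i j)"
    using assms by (subst Pi_pmf_component[OF finite_edge_slots]) simp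
  finally show ?thesis .
qed

lemma inhom_ER_indep:
  "prob_space.indep_vars (measure_pmf (inhom_ER n p)) (\<lambda>_. count_space UNIV)
     (\<lambda>(i, j) A. A $$ (i, j)) {(i, j). i < j \<and> j < n}"
proof -
  let ?S = "{(i, j). i < j \<and> j < n}"
  let ?P = "Pi_pmf ?S False (\<lambda>(i, j). bernoulli_pmf (p i j))"
  have "prob_space.indep_vars (measure_pmf ?P) (\<lambda>_. count_space UNIV) (\<lambda>e x. x e) ?S"
    by (rule indep_vars_Pi_pmf[OF finite_edge_slots])
  then have "prob_space.indep_vars (measure_pmf ?P) (\<lambda>_. count_space UNIV)
      (\<lambda>e x. (of_bool (x e) :: real)) ?S"
    by (rule prob_space.indep_vars_compose2[OF measure_pmf.prob_space_axioms]) simp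
  then have *: "prob_space.indep_vars (measure_pmf ?P) (\<lambda>_. count_space UNIV)
      (\<lambda>e x. adjacency_mat n x $$ e) ?S"
    by (subst prob_space.indep_vars_cong[OF measure_pmf.prob_space_axioms refl _ refl])
       (auto simp: adjacency_mat_def)
  show ?thesis
    unfolding prob_space.indep_vars_def2[OF measure_pmf.prob_space_axioms]
      prob_space.indep_sets_def[OF measure_pmf.prob_space_axioms]
  proof (intro conjI ballI allI impI)
    fix J F
    assume J: "J \<subseteq> ?S" "J \<noteq> {}" "finite J"
      and F: "F \<in> Pi J (\<lambda>e. {(case e of (i, j) \<Rightarrow> \<lambda>A. A $$ (i, j)) -` B
        \<inter> space (measure_pmf (inhom_ER n p)) |B. B \<in> sets (count_space (UNIV :: real set))})"
    let ?F = "\<lambda>e. adjacency_mat n -` F e"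
    have "?F \<in> Pi J (\<lambda>e. {(\<lambda>x. adjacency_mat n x $$ e) -` B
        \<inter> space (measure_pmf ?P) |B. B \<in> sets (count_space (UNIV :: real set))})"
      using F by (fastforce simp: Pi_iff)
    then have "measure_pmf.prob ?P (\<Inter>e\<in>J. ?F e) = (\<Prod>e\<in>J. measure_pmf.prob ?P (?F e))"
      using * J
      unfolding prob_space.indep_vars_def2[OF measure_pmf.prob_space_axioms]
        prob_space.indep_sets_def[OF measure_pmf.prob_space_axioms]
      by blast
    then show "measure_pmf.prob (inhom_ER n p) (\<Inter> (F ` J))
        = (\<Prod>e\<in>J. measure_pmf.prob (inhom_ER n p) (F e))"
      by (simp add: inhom_ER_def vimage_INT)
  qed auto
qed

end

theory Submission
  imports Defs
begin

text \<open>
  Put \<open>K = \<tau> + d\<close>. When \<open>\<tau> < 1\<close> the norm is at most \<open>2\<close>, which is below the threshold, so let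
  \<open>\<tau> \<ge> 1\<close>. The heart of the matter is that, with probability \<open>1 - 4 e\<^sup>-\<^sup>R\<close>, the quadratic form of
  \<open>A - \<bbbE>A\<close> at \<open>z\<close> is at most \<open>C R \<surd>K \<bar>z\<bar>\<^sup>2 + (C / \<surd>K) \<Sum>\<^sub>i deg\<^sub>i z\<^sub>i\<^sup>2\<close> for all \<open>z\<close> at once. There is no
  logarithm because the vertices of large degree are absorbed by the second term, and at
  \<open>z = D\<^sup>-\<^sup>1\<^sup>/\<^sup>2 x\<close> both terms are of order \<open>\<surd>K / \<tau>\<close>.

  A form with zero diagonal is affine in each coordinate, so its maximum over a box is attained at a
  vertex, and it suffices to treat vectors \<open>y\<close> with entries \<open>0\<close> or \<open>\<plusminus>2\<^sup>b\<close> and \<open>\<bar>y\<bar>\<^sup>2 \<le> 5 n\<close>. Pairs with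
  \<open>\<bar>y\<^sub>i y\<^sub>j\<bar> \<le> \<surd>K\<close> are handled by a Chernoff bound and a union bound over all \<open>y\<close>. Pairs whose entries
  differ by a factor larger than \<open>\<surd>K\<close> go into the degree term. The other pairs are grouped by their
  smaller entry \<open>2\<^sup>a\<close>: only the entries of size at least \<open>2\<^sup>a\<close> matter, and these are few, so the union
  bound is cheap and a larger exponential tilt, growing like \<open>a + 1\<close>, is affordable.

  What remains is the replacement of the random degrees \<open>D\<^sub>i\<close> by their means \<open>E\<^sub>i\<close> in the expected part.
  Its Hilbert-Schmidt norm is at most \<open>2 (\<surd>K / \<tau>) (\<Sum>\<^sub>i (D\<^sub>i - E\<^sub>i)\<^sup>2 / (n E\<^sub>i))\<^sup>1\<^sup>/\<^sup>2\<close>, and the average is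
  controlled by an exponential moment.
\<close>

section \<open>Union bounds for Bernoulli sums over dyadic vectors\<close>

definition slots :: "nat \<Rightarrow> (nat \<times> nat) set" where
  "slots n = {(i, j). i < j \<and> j < n}"

lemma finite_slots [simp]: "finite (slots n)"
  unfolding slots_def by (rule finite_edge_slots)

abbreviation bernoulli_product :: "'e set \<Rightarrow> ('e \<Rightarrow> real) \<Rightarrow> ('e \<Rightarrow> bool) pmf" where
  "bernoulli_product S q \<equiv> Pi_pmf S False (\<lambda>e. bernoulli_pmf (q e))"

lemma finite_set_bernoulli_product:
  assumes "finite S"
  shows "finite (set_pmf (bernoulli_product S q))"
proof -
  have "set_pmf (bernoulli_product S q) \<subseteq> PiE_dflt S False (\<lambda>_. UNIV)"
    using assms by (auto simp: set_Pi_pmf PiE_dflt_def)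
  moreover have "finite (PiE_dflt S False (\<lambda>_. UNIV :: bool set))"
    using assms by (intro finite_PiE_dflt) auto
  ultimately show ?thesis by (rule finite_subset)
qed

text \<open>By independence the expectation factors over \<open>S\<close>, and
  \<open>1 + t \<le> exp t\<close> turns each Bernoulli factor into an exponential.\<close>

lemma expectation_exp_le:
  fixes q c :: "'e \<Rightarrow> real"
  assumes "finite S" and q: "\<And>e. e \<in> S \<Longrightarrow> 0 \<le> q e \<and> q e \<le> 1"
  shows "measure_pmf.expectation (bernoulli_product S q) (\<lambda>x. exp (\<Sum>e\<in>S. c e * of_bool (x e)))
    \<le> exp (\<Sum>e\<in>S. q e * (exp (c e) - 1))"
proof -
  have "measure_pmf.expectation (bernoulli_product S q) (\<lambda>x. exp (\<Sum>e\<in>S. c e * of_bool (x e)))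
    = measure_pmf.expectation (bernoulli_product S q) (\<lambda>x. \<Prod>e\<in>S. exp (c e * of_bool (x e)))"
    by (simp only: exp_sum[OF assms(1)])
  also have "\<dots> = (\<Prod>e\<in>S. measure_pmf.expectation (bernoulli_pmf (q e)) (\<lambda>b. exp (c e * of_bool b)))"
    using assms(1) by (intro expectation_prod_Pi_pmf integrable_measure_pmf_finite) auto
  also have "\<dots> = (\<Prod>e\<in>S. 1 + q e * (exp (c e) - 1))"
    using q by (intro prod.cong refl) (simp add: algebra_simps)
  also have "\<dots> \<le> (\<Prod>e\<in>S. exp (q e * (exp (c e) - 1)))"
  proof (rule prod_mono)
    fix e assume "e \<in> S"
    \<comment> \<open>Multiplying the inequalities also takes nonnegative factors; each factor is a
      convex combination of 1 and \<open>exp (c e)\<close>.\<close>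
    then have "0 \<le> (1 - q e) + q e * exp (c e)"
      using q by (intro add_nonneg_nonneg mult_nonneg_nonneg) auto
    then show "0 \<le> 1 + q e * (exp (c e) - 1) \<and>
      1 + q e * (exp (c e) - 1) \<le> exp (q e * (exp (c e) - 1))"
      using exp_ge_add_one_self[of "q e * (exp (c e) - 1)"] by (simp add: algebra_simps)
  qed
  also have "\<dots> = exp (\<Sum>e\<in>S. q e * (exp (c e) - 1))"
    using assms(1) by (simp add: exp_sum)
  finally show ?thesis .
qed

lemma prob_ge_le_expectation:
  fixes f :: "'a \<Rightarrow> real"
  assumes "finite (set_pmf P)" "\<And>x. 0 \<le> f x" "0 < t"
  shows "measure_pmf.prob P {x. t \<le> f x} \<le> measure_pmf.expectation P f / t"
proof -
  have "measure_pmf.prob P {x \<in> space (measure_pmf P). t \<le> f x}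
      \<le> measure_pmf.expectation P f / t"
    by (rule integral_Markov_inequality_measure[where A = "{}"])
       (use assms in \<open>auto intro!: integrable_measure_pmf_finite\<close>)
  then show ?thesis by simp
qed

text \<open>Markov's inequality for the exponential moment. The tilt is already contained in
  \<open>c\<close>, so it may vary from one index to another.\<close>

lemma chernoff_bound:
  fixes q c :: "'e \<Rightarrow> real"
  assumes "finite S" and q: "\<And>e. e \<in> S \<Longrightarrow> 0 \<le> q e \<and> q e \<le> 1"
  shows "measure_pmf.prob (bernoulli_product S q)
      {x. (\<Sum>e\<in>S. q e * (exp (c e) - 1)) + t \<le> (\<Sum>e\<in>S. c e * of_bool (x e))} \<le> exp (- t)"
    (is "measure_pmf.prob ?P {x. ?m + t \<le> ?X x} \<le> _")
proof -
  have "{x. ?m + t \<le> ?X x} = {x. exp (?m + t) \<le> exp (?X x)}" by simp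
  then have "measure_pmf.prob ?P {x. ?m + t \<le> ?X x}
      \<le> measure_pmf.expectation ?P (\<lambda>x. exp (?X x)) / exp (?m + t)"
    using prob_ge_le_expectation[OF finite_set_bernoulli_product[OF assms(1)],
        of "\<lambda>x. exp (?X x)" "exp (?m + t)" q]
    by simp
  also have "\<dots> \<le> exp ?m / exp (?m + t)"
    by (intro divide_right_mono expectation_exp_le assms) auto
  also have "\<dots> = exp (- t)" by (simp add: exp_add exp_minus field_simps)
  finally show ?thesis .
qed

text \<open>The lower exponent \<open>a\<close> singles out vectors with large nonzero entries; the
  upper exponent \<open>B\<close> keeps the union bound finite.\<close>

definition dyadics :: "nat \<Rightarrow> nat \<Rightarrow> real set" where
  "dyadics a B = insert 0 ((\<lambda>b. 2 ^ b) ` {a..B} \<union> (\<lambda>b. - (2 ^ b)) ` {a..B})"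

lemma finite_dyadics [simp]: "finite (dyadics a B)"
  by (simp add: dyadics_def)

lemma dyadicsE:
  assumes "l \<in> dyadics a B"
  obtains "l = 0" | b where "a \<le> b" "b \<le> B" "\<bar>l\<bar> = 2 ^ b"
  using assms by (auto simp: dyadics_def)

lemma sum_eighth_power_le: "(\<Sum>b=a..B. (1/8::real) ^ b) \<le> (3/2) * (1/8) ^ a"
proof (cases "a \<le> B")
  case True
  have "(\<Sum>b=a..B. (1/8::real) ^ b) = ((1/8) ^ a - (1/8) ^ Suc B) / (1 - 1/8)"
    using True by (subst sum_gp) auto
  also have "\<dots> \<le> (3/2) * (1/8) ^ a"
    by (simp add: field_simps)
  finally show ?thesis .
qed auto

text \<open>The weight \<open>\<bar>l\<bar>\<^sup>-\<^sup>3\<close> (and 1 at \<open>l = 0\<close>, since \<open>ln 0 = 0\<close>) is a prior on these numbers. The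
  union bound then charges \<open>3 ln \<bar>y\<^sub>i\<bar>\<close> for each nonzero entry, and only \<open>3 n / 8 ^ a\<close> for all vectors whose
  nonzero entries have modulus at least \<open>2 ^ a\<close>; this remains summable after multiplication by \<open>4 ^ a\<close>.\<close>

lemma sum_dyadics_weight_le: "(\<Sum>l\<in>dyadics a B. exp (- (3 * ln \<bar>l\<bar>))) \<le> 1 + 3 * (1/8) ^ a"
proof -
  let ?w = "\<lambda>l::real. exp (- (3 * ln \<bar>l\<bar>))"
  have w: "?w (2 ^ b) = (1/8) ^ b" "?w (- (2 ^ b)) = (1/8) ^ b" for b
  proof -
    have "exp (3 * ln ((2::real) ^ b)) = (2 ^ b) ^ 3"
      using exp_of_nat_mult[of 3 "ln ((2::real) ^ b)"] by simp
    also have "\<dots> = (2 ^ 3) ^ b" by (simp only: power_mult[symmetric] mult.commute)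
    finally have "?w (2 ^ b) = (1/8) ^ b"
      by (simp add: exp_minus power_one_over inverse_eq_divide)
    then show "?w (2 ^ b) = (1/8) ^ b" by simp
    then show "?w (- (2 ^ b)) = (1/8) ^ b" by simp
  qed
  let ?I = "(\<lambda>b. 2 ^ b) ` {a..B} :: real set" and ?J = "(\<lambda>b. - (2 ^ b)) ` {a..B} :: real set"
  have "(\<Sum>l\<in>dyadics a B. ?w l) = ?w 0 + (\<Sum>l\<in>?I \<union> ?J. ?w l)"
    unfolding dyadics_def by (subst sum.insert) auto
  also have "(\<Sum>l\<in>?I \<union> ?J. ?w l) = (\<Sum>l\<in>?I. ?w l) + (\<Sum>l\<in>?J. ?w l)"
  proof (intro sum.union_disjoint)
    have "(2::real) ^ b \<noteq> - (2 ^ b')" for b b'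
      using zero_less_power[of "2::real" b] zero_less_power[of "2::real" b'] by linarith
    then show "?I \<inter> ?J = {}" by auto
  qed auto
  also have "(\<Sum>l\<in>?I. ?w l) \<le> (\<Sum>b=a..B. (1/8) ^ b)"
    by (rule order.trans[OF sum_image_le]) (use w in \<open>auto simp: o_def\<close>)
  also have "(\<Sum>l\<in>?J. ?w l) \<le> (\<Sum>b=a..B. (1/8) ^ b)"
    by (rule order.trans[OF sum_image_le]) (use w in \<open>auto simp: o_def\<close>)
  also note sum_eighth_power_le[of a B]
  finally show ?thesis by simp
qed

text \<open>A Chernoff bound for each \<open>y\<close>, with the threshold raised by the logarithm
  of the inverse prior weight of \<open>y\<close>. The sum of all weights factors over the
  coordinates and is at most \<open>exp (3 * n / 8 ^ a)\<close>; the second term of the threshold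
  cancels it.\<close>

lemma dyadic_union_bound:
  fixes q :: "'e \<Rightarrow> real" and c :: "(nat \<Rightarrow> real) \<Rightarrow> 'e \<Rightarrow> real"
  assumes "finite S" and q: "\<And>e. e \<in> S \<Longrightarrow> 0 \<le> q e \<and> q e \<le> 1"
  shows "measure_pmf.prob (bernoulli_product S q)
      {x. \<exists>y \<in> PiE {..<n} (\<lambda>_. dyadics a B).
        (\<Sum>e\<in>S. q e * (exp (c y e) - 1)) + (3 * (\<Sum>i<n. ln \<bar>y i\<bar>) + 3 * real n * (1/8) ^ a + R)
          \<le> (\<Sum>e\<in>S. c y e * of_bool (x e))} \<le> exp (- R)"
    (is "measure_pmf.prob ?P {x. \<exists>y\<in>?Y. ?m y + (3 * ?l y + ?k + R) \<le> ?X y x} \<le> _")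
proof -
  have [simp]: "finite ?Y" by (intro finite_PiE) auto
  have "{x. \<exists>y\<in>?Y. ?m y + (3 * ?l y + ?k + R) \<le> ?X y x}
      = (\<Union>y\<in>?Y. {x. ?m y + (3 * ?l y + ?k + R) \<le> ?X y x})" by auto
  then have "measure_pmf.prob ?P {x. \<exists>y\<in>?Y. ?m y + (3 * ?l y + ?k + R) \<le> ?X y x}
      \<le> (\<Sum>y\<in>?Y. measure_pmf.prob ?P {x. ?m y + (3 * ?l y + ?k + R) \<le> ?X y x})"
    by (simp, intro measure_pmf.finite_measure_subadditive_finite) auto
  also have "\<dots> \<le> (\<Sum>y\<in>?Y. exp (- (3 * ?l y + ?k + R)))"
    by (intro sum_mono chernoff_bound assms)
  also have "\<dots> = (\<Sum>y\<in>?Y. \<Prod>i<n. exp (- (3 * ln \<bar>y i\<bar>))) * exp (- (?k + R))"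
    unfolding sum_distrib_right
  proof (rule sum.cong[OF refl])
    fix y
    have "(\<Prod>i<n. exp (- (3 * ln \<bar>y i\<bar>))) = exp (- (3 * ?l y))"
      by (subst exp_sum[symmetric]) (auto simp: sum_negf sum_distrib_left)
    then show "exp (- (3 * ?l y + ?k + R)) = (\<Prod>i<n. exp (- (3 * ln \<bar>y i\<bar>))) * exp (- (?k + R))"
      by (simp add: mult_exp_exp)
  qed
  also have "(\<Sum>y\<in>?Y. \<Prod>i<n. exp (- (3 * ln \<bar>y i\<bar>))) = (\<Prod>i<n. \<Sum>l\<in>dyadics a B. exp (- (3 * ln \<bar>l\<bar>)))"
    by (subst prod_sum_PiE) auto
  also have "\<dots> \<le> (\<Prod>i<n. exp (3 * (1/8) ^ a))"
  proof (intro prod_mono conjI sum_nonneg)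
    show "(\<Sum>l\<in>dyadics a B. exp (- (3 * ln \<bar>l\<bar>))) \<le> exp (3 * (1/8) ^ a)"
      using sum_dyadics_weight_le[of a B] exp_ge_add_one_self[of "3 * (1/8) ^ a :: real"] by linarith
  qed auto
  also have "\<dots> = exp ?k" by (simp add: exp_of_nat_mult[symmetric] mult_ac)
  also have "exp ?k * exp (- (?k + R)) = exp (- R)" by (simp add: mult_exp_exp)
  finally show ?thesis by simp
qed

section \<open>Rounding to dyadic vectors\<close>

text \<open>The coordinates are moved to end points one at a time: an affine function of one
  variable is largest at an end of the interval.\<close>

lemma multiaffine_le_vertices:
  fixes f :: "(nat \<Rightarrow> real) \<Rightarrow> real"
  assumes affine: "\<And>z i. \<exists>\<alpha> \<beta>. \<forall>t. f (z(i := t)) = \<alpha> + \<beta> * t"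
    and vertices: "\<And>y. (\<And>i. i < n \<Longrightarrow> y i \<in> {l i, u i}) \<Longrightarrow> f y \<le> c"
    and box: "\<And>i. i < n \<Longrightarrow> l i \<le> z i \<and> z i \<le> u i"
  shows "f z \<le> c"
proof -
  \<comment> \<open>Induction on \<open>k\<close>: the first \<open>k\<close> coordinates range over
    their intervals, and the others already sit at end points.\<close>
  have "\<forall>z. (\<forall>i<k. l i \<le> z i \<and> z i \<le> u i) \<longrightarrow> (\<forall>i<n. k \<le> i \<longrightarrow> z i \<in> {l i, u i})
      \<longrightarrow> f z \<le> c" if "k \<le> n" for k
    using that
  proof (induction k)
    case 0
    then show ?case using vertices by blast
  next
    case (Suc k)
    show ?case
    proof (intro allI impI)
      fix z
      assume z: "\<forall>i<Suc k. l i \<le> z i \<and> z i \<le> u i" "\<forall>i<n. Suc k \<le> i \<longrightarrow> z i \<in> {l i, u i}"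
      have "f (z(k := t)) \<le> c" if "t \<in> {l k, u k}" for t
      proof -
        have "\<forall>i<k. l i \<le> (z(k := t)) i \<and> (z(k := t)) i \<le> u i" using z by auto
        moreover have "\<forall>i<n. k \<le> i \<longrightarrow> (z(k := t)) i \<in> {l i, u i}"
          using z that by (auto simp: le_eq_less_or_eq Suc_le_eq)
        ultimately show ?thesis using Suc by auto
      qed
      then have lu: "f (z(k := l k)) \<le> c" "f (z(k := u k)) \<le> c" by auto
      obtain \<alpha> \<beta> where ab: "\<And>t. f (z(k := t)) = \<alpha> + \<beta> * t" using affine[of z k] by blast
      have "f z = \<alpha> + \<beta> * z k" using ab[of "z k"] by simp
      moreover have "\<beta> * z k \<le> \<beta> * l k \<or> \<beta> * z k \<le> \<beta> * u k"
        using z(1) by (cases "\<beta> \<ge> 0") (auto intro: mult_left_mono mult_left_mono_neg)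
      ultimately show "f z \<le> c" using lu ab by fastforce
    qed
  qed
  from this[of n] show ?thesis using box by auto
qed

section \<open>Quadratic forms over unordered pairs\<close>

text \<open>Half the quadratic form of the symmetric matrix with zero diagonal whose entries above
  the diagonal are given by \<open>m\<close>.\<close>

definition slot_form :: "nat \<Rightarrow> (nat \<times> nat \<Rightarrow> real) \<Rightarrow> (nat \<Rightarrow> real) \<Rightarrow> real" where
  "slot_form n m z = (\<Sum>(i, j)\<in>slots n. m (i, j) * (z i * z j))"

text \<open>A slot joins two distinct vertices, so no square of a coordinate occurs.\<close>

lemma slot_form_affine: "\<exists>\<alpha> \<beta>. \<forall>t. slot_form n m (z(k := t)) = \<alpha> + \<beta> * t"
proof (intro exI allI)
  fix t
  show "slot_form n m (z(k := t)) = (\<Sum>(i, j)\<in>slots n. if i = k \<or> j = k then 0 else m (i, j) * (z i * z j))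
    + (\<Sum>(i, j)\<in>slots n. if i = k then m (i, j) * z j else if j = k then m (i, j) * z i else 0) * t"
    unfolding slot_form_def sum_distrib_right sum.distrib[symmetric]
    by (rule sum.cong) (auto simp: slots_def)
qed

lemma slot_form_cong: "(\<And>i. i < n \<Longrightarrow> y i = z i) \<Longrightarrow> slot_form n m y = slot_form n m z"
  unfolding slot_form_def by (rule sum.cong) (auto simp: slots_def)

lemma sum_square_slots:
  fixes g :: "nat \<Rightarrow> nat \<Rightarrow> real"
  shows "(\<Sum>i<n. \<Sum>j<n. g i j) = (\<Sum>(i, j)\<in>slots n. g i j + g j i) + (\<Sum>i<n. g i i)"
proof -
  let ?T = "{(i, j). j < i \<and> i < n}" and ?D = "(\<lambda>i. (i, i)) ` {..<n}"
  have T: "?T = prod.swap ` slots n" by (auto simp: slots_def)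
  have "(\<Sum>i<n. \<Sum>j<n. g i j) = (\<Sum>(i, j)\<in>{..<n} \<times> {..<n}. g i j)"
    by (simp add: sum.cartesian_product)
  also have "{..<n} \<times> {..<n} = (slots n \<union> ?T) \<union> ?D" by (auto simp: slots_def)
  also have "(\<Sum>(i, j)\<in>(slots n \<union> ?T) \<union> ?D. g i j)
      = ((\<Sum>(i, j)\<in>slots n. g i j) + (\<Sum>(i, j)\<in>?T. g i j)) + (\<Sum>(i, j)\<in>?D. g i j)"
    by (subst sum.union_disjoint; (subst sum.union_disjoint)?) (auto simp: T, auto simp: slots_def)
  also have "(\<Sum>(i, j)\<in>?T. g i j) = (\<Sum>(i, j)\<in>slots n. g j i)"
    unfolding T by (subst sum.reindex) (auto simp: o_def case_prod_beta)
  also have "(\<Sum>(i, j)\<in>?D. g i j) = (\<Sum>i<n. g i i)"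
    by (subst sum.reindex) (auto simp: inj_on_def)
  finally show ?thesis by (simp add: sum.distrib case_prod_beta)
qed

text \<open>Expanding the square counts every slot twice, and the diagonal that is dropped consists
  of squares.\<close>

lemma sum_slots_mult_le:
  fixes u :: "nat \<Rightarrow> real"
  shows "(\<Sum>(i, j)\<in>slots n. u i * u j) \<le> (\<Sum>i<n. u i)\<^sup>2 / 2"
proof -
  have "(\<Sum>i<n. u i)\<^sup>2 = (\<Sum>i<n. \<Sum>j<n. u i * u j)" by (simp add: power2_eq_square sum_product)
  also have "\<dots> = (\<Sum>(i, j)\<in>slots n. 2 * (u i * u j)) + (\<Sum>i<n. u i * u i)"
    by (subst sum_square_slots) (simp add: mult.commute)
  also have "(\<Sum>(i, j)\<in>slots n. 2 * (u i * u j)) = 2 * (\<Sum>(i, j)\<in>slots n. u i * u j)"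
    by (simp add: sum_distrib_left case_prod_beta)
  finally show ?thesis using sum_nonneg[of "{..<n}" "\<lambda>i. u i * u i"] by simp
qed

lemma dyadics_uminus: "l \<in> dyadics a B \<Longrightarrow> - l \<in> dyadics a B"
  by (auto simp: dyadics_def)

text \<open>For \<open>t > 1\<close> consecutive powers of two enclose \<open>t\<close>, so their
  squares are at most \<open>4 * t^2\<close>. Below 1 the bracket is 0 and 1, which accounts for the
  added 1. Negation swaps the two ends.\<close>

lemma dyadic_bracket:
  fixes t :: real
  assumes t: "t\<^sup>2 \<le> real n" and B: "5 * real n < 4 ^ Suc B"
  obtains l u where "l \<in> dyadics 0 B" "u \<in> dyadics 0 B" "l \<le> t" "t \<le> u"
    "l\<^sup>2 \<le> 4 * t\<^sup>2 + 1" "u\<^sup>2 \<le> 4 * t\<^sup>2 + 1"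
proof -
  have pos: "\<exists>l\<in>dyadics 0 B. \<exists>u\<in>dyadics 0 B. l \<le> t \<and> t \<le> u \<and> l\<^sup>2 \<le> 4 * t\<^sup>2 + 1 \<and> u\<^sup>2 \<le> 4 * t\<^sup>2 + 1"
    if "0 \<le> t" and t: "t\<^sup>2 \<le> real n" for t :: real
  proof (cases "t \<le> 1")
    case True
    have "(0::real) \<in> dyadics 0 B" "(1::real) \<in> dyadics 0 B"
      by (auto simp: dyadics_def intro!: image_eqI[of _ _ 0])
    then show ?thesis using True that
      by (intro bexI[of _ 0] bexI[of _ 1]) auto
  next
    case False
    \<comment> \<open>Powers of two are integers, so \<open>t\<close> and its floor lie in the same
      dyadic interval.\<close>
    define k where "k = nat \<lfloor>t\<rfloor>"
    have k: "1 \<le> k" "real k \<le> t" "t < real k + 1" using False that by (auto simp: k_def le_nat_floor)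
    obtain b where "2 ^ b \<le> k" "k < 2 ^ (b + 1)" using ex_power_ivl1[of 2 k] k by auto
    then have "real (2 ^ b) \<le> real k" "real (k + 1) \<le> real (2 ^ Suc b)"
      by (simp_all only: of_nat_le_iff Suc_eq_plus1)
    then have b: "2 ^ b \<le> t" "t < 2 ^ Suc b"
      using k by (simp_all only: of_nat_power of_nat_numeral of_nat_add of_nat_1)
    have sq: "(2 ^ b)\<^sup>2 = (4::real) ^ b" for b
      by (simp add: power_mult[symmetric] mult.commute[of b 2] power_mult)
    have bt: "4 ^ b \<le> t\<^sup>2" using power_mono[OF b(1), of 2] sq by simp
    \<comment> \<open>Here \<open>4 ^ Suc b \<le> 4 * t^2 \<le> 5 * n\<close>, so even the upper end
      of the bracket has exponent at most \<open>B\<close>.\<close>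
    have "(4::real) ^ Suc b < 4 ^ Suc B" using bt t B unfolding power_Suc by linarith
    then have "Suc b < Suc B" by (rule power_less_imp_less_exp[rotated]) simp
    then have "b < B" by simp
    then have "(2::real) ^ b \<in> dyadics 0 B" "(2::real) ^ Suc b \<in> dyadics 0 B"
      by (auto simp: dyadics_def simp del: power_Suc)
    moreover have "(2 ^ b)\<^sup>2 \<le> 4 * t\<^sup>2 + 1" "(2 ^ Suc b)\<^sup>2 \<le> 4 * t\<^sup>2 + 1"
      using bt zero_le_power2[of t] unfolding sq unfolding power_Suc by linarith+
    ultimately show ?thesis using b by (blast intro: less_imp_le)
  qed
  show thesis
  proof (cases "0 \<le> t")
    case True
    then show ?thesis using pos[of t] t that by blast
  next
    case False
    then obtain l u where "l \<in> dyadics 0 B" "u \<in> dyadics 0 B" "l \<le> - t" "- t \<le> u"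
      "l\<^sup>2 \<le> 4 * t\<^sup>2 + 1" "u\<^sup>2 \<le> 4 * t\<^sup>2 + 1"
      using pos[of "- t"] t by auto
    then show ?thesis using that[of "- u" "- l"] dyadics_uminus by auto
  qed
qed

section \<open>Scalar inequalities for the tilts\<close>

text \<open>For \<open>c = - u < 0\<close> the chain is
  \<open>exp (- u) \<le> 1 / (1 + u) \<le> 1 - u + u^2\<close>. The linear term later cancels
  against the mean, and the quadratic term is the variance proxy.\<close>

lemma exp_quadratic_bound:
  fixes c :: real
  assumes "\<bar>c\<bar> \<le> 1"
  shows "exp c - 1 \<le> c + c\<^sup>2"
proof (cases "0 \<le> c")
  case True
  then show ?thesis using exp_bound[of c] assms by simp
next
  case False
  define u where "u = - c"
  have u: "0 < u" "c = - u" using False by (auto simp: u_def)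
  have "exp c = 1 / exp u" using u by (simp add: exp_minus inverse_eq_divide)
  also have "\<dots> \<le> 1 / (1 + u)"
    using exp_ge_add_one_self[of u] u by (intro divide_left_mono) auto
  also have "\<dots> \<le> 1 - u + u\<^sup>2"
  proof -
    have "(1 - u + u\<^sup>2) * (1 + u) = 1 + u ^ 3" by (simp add: algebra_simps power2_eq_square power3_eq_cube)
    then show ?thesis using u by (simp add: pos_divide_le_eq)
  qed
  finally show ?thesis using u by simp
qed

text \<open>The exponential is convex and the bound is linear in \<open>\<rho>\<close>: only the end points matter.\<close>

lemma exp_level_bound:
  fixes \<rho> :: real
  assumes "(1/4) ^ a \<le> \<rho>" "\<rho> \<le> 1"
  shows "exp ((real a + 1) * \<rho>) \<le> exp 1 * (\<rho> * 4 ^ a)"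
\<comment> \<open>For \<open>a = 0\<close> the two end points coincide, and
  \<open>1 - \<epsilon>\<close> would vanish as a denominator.\<close>
proof (cases "a = 0")
  case True
  then show ?thesis using assms by simp
next
  case False
  define \<epsilon> :: real where "\<epsilon> = (1/4) ^ a"
  have \<epsilon>: "0 < \<epsilon>" "\<epsilon> < 1" "\<epsilon> * 4 ^ a = 1"
    using False by (auto simp: \<epsilon>_def power_mult_distrib[symmetric] power_less_one_iff)
  define \<mu> where "\<mu> = (\<rho> - \<epsilon>) / (1 - \<epsilon>)"
  have \<mu>: "0 \<le> \<mu>" "\<mu> \<le> 1" "\<rho> = (1 - \<mu>) * \<epsilon> + \<mu>"
  proof -
    show "0 \<le> \<mu>" "\<mu> \<le> 1" using assms \<epsilon> by (auto simp: \<mu>_def \<epsilon>_def)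
    have "\<mu> * (1 - \<epsilon>) = \<rho> - \<epsilon>" using \<epsilon> by (simp add: \<mu>_def)
    then show "\<rho> = (1 - \<mu>) * \<epsilon> + \<mu>" by (simp add: algebra_simps)
  qed
  have a4: "real a + 1 \<le> 4 ^ a"
    using Bernoulli_inequality[of "3::real" a] by simp
  have "(real a + 1) * \<epsilon> \<le> 4 ^ a * \<epsilon>" using a4 \<epsilon> by (intro mult_right_mono) auto
  then have e1: "exp ((real a + 1) * \<epsilon>) \<le> exp 1" using \<epsilon> by (simp add: mult.commute)
  have "exp (real a) \<le> 4 ^ a"
    using exp_le power_mono[of "exp (1::real)" 4 a] by (simp add: exp_of_nat_mult[symmetric])
  then have e2: "exp (real a + 1) \<le> exp 1 * 4 ^ a"
    by (simp add: exp_add)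
  have "exp ((1 - \<mu>) *\<^sub>R ((real a + 1) * \<epsilon>) + \<mu> *\<^sub>R (real a + 1))
      \<le> (1 - \<mu>) * exp ((real a + 1) * \<epsilon>) + \<mu> * exp (real a + 1)"
    using \<mu> by (intro convex_onD[OF exp_convex]) auto
  also have "\<dots> \<le> (1 - \<mu>) * exp 1 + \<mu> * (exp 1 * 4 ^ a)"
    using \<mu> e1 e2 by (intro add_mono mult_left_mono) auto
  also have "\<dots> = exp 1 * (\<rho> * 4 ^ a)"
    using \<epsilon>(3) by (simp add: \<mu>(3) algebra_simps)
  also have "(1 - \<mu>) *\<^sub>R ((real a + 1) * \<epsilon>) + \<mu> *\<^sub>R (real a + 1) = (real a + 1) * \<rho>"
    by (simp add: \<mu>(3) algebra_simps)
  finally show ?thesis .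
qed

text \<open>The terms grow geometrically, so the last one dominates. The denominator
  \<open>b + 1\<close> that survives is what later cancels the logarithm of an entry
  \<open>2 ^ b\<close>.\<close>

lemma sum_power_div_le: "(\<Sum>a\<le>b. 4 ^ a / (real a + 1)) \<le> 4 * 4 ^ b / (real b + 1)"
proof (induction b)
  case (Suc b)
  have "4 * 4 ^ b / (real b + 1) + 4 ^ Suc b / (real (Suc b) + 1) \<le> 4 * 4 ^ Suc b / (real (Suc b) + 1)"
    by (simp add: divide_simps)
  then show ?case using Suc by simp
qed simp

section \<open>Light and heavy pairs\<close>

definition edge_min :: "(nat \<Rightarrow> real) \<Rightarrow> nat \<times> nat \<Rightarrow> real" where
  "edge_min y e = min \<bar>y (fst e)\<bar> \<bar>y (snd e)\<bar>"

definition edge_max :: "(nat \<Rightarrow> real) \<Rightarrow> nat \<times> nat \<Rightarrow> real" where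
  "edge_max y e = max \<bar>y (fst e)\<bar> \<bar>y (snd e)\<bar>"

abbreviation edge_prod :: "(nat \<Rightarrow> real) \<Rightarrow> nat \<times> nat \<Rightarrow> real" where
  "edge_prod y e \<equiv> y (fst e) * y (snd e)"

lemma edge_min_max: "0 \<le> edge_min y e" "edge_min y e \<le> edge_max y e" "0 \<le> edge_max y e"
  "edge_min y e * edge_max y e = \<bar>edge_prod y e\<bar>"
  "(edge_min y e * edge_max y e)\<^sup>2 = (edge_prod y e)\<^sup>2"
proof -
  show *: "edge_min y e * edge_max y e = \<bar>edge_prod y e\<bar>"
    by (auto simp: edge_min_def edge_max_def min_def max_def abs_mult)
  show "(edge_min y e * edge_max y e)\<^sup>2 = (edge_prod y e)\<^sup>2" unfolding * by simp
qed (auto simp: edge_min_def edge_max_def)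

lemma sum_slots_edge_prod_le: "(\<Sum>e\<in>slots n. (edge_prod y e)\<^sup>2) \<le> (\<Sum>i<n. (y i)\<^sup>2)\<^sup>2 / 2"
  using sum_slots_mult_le[of "\<lambda>i. (y i)\<^sup>2" n]
  by (simp add: case_prod_beta power_mult_distrib)

lemma ln_abs_le_square: "ln \<bar>t::real\<bar> \<le> t\<^sup>2"
proof (cases "t = 0")
  case False
  then have "ln \<bar>t\<bar> \<le> \<bar>t\<bar> - 1" using ln_le_minus_one[of "\<bar>t\<bar>"] by simp
  also have "\<dots> \<le> t\<^sup>2"
    using zero_le_power2[of "\<bar>t\<bar> - 1"] by (simp add: power2_diff)
  finally show ?thesis .
qed simp

text \<open>Division by \<open>sqrt K\<close> keeps the tilt in \<open>[-1, 1]\<close>, where the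
  quadratic bound on the exponential is valid.\<close>

definition light_tilt :: "real \<Rightarrow> (nat \<Rightarrow> real) \<Rightarrow> nat \<times> nat \<Rightarrow> real" where
  "light_tilt K y e = (if edge_min y e * edge_max y e \<le> sqrt K then edge_prod y e / sqrt K else 0)"

text \<open>Since \<open>q e \<le> K / n\<close>, the second order terms are at most the squared
  products divided by \<open>n\<close>, in total \<open>25 n / 2\<close>. The union bound adds
  \<open>15 n\<close> for the logarithms and \<open>3 n\<close> for the normalization, and 30.5 is
  rounded up to 31. The sign \<open>s\<close> gives both tails.\<close>

lemma light_event:
  fixes q :: "nat \<times> nat \<Rightarrow> real"
  assumes K: "1 \<le> K" and n: "1 \<le> n"
    and q: "\<And>e. e \<in> slots n \<Longrightarrow> 0 \<le> q e \<and> q e \<le> 1"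
    and qK: "\<And>e. e \<in> slots n \<Longrightarrow> q e \<le> K / real n"
    and s: "\<bar>s\<bar> = 1"
  shows "measure_pmf.prob (bernoulli_product (slots n) q)
    {x. \<exists>y \<in> PiE {..<n} (\<lambda>_. dyadics 0 B). (\<Sum>i<n. (y i)\<^sup>2) \<le> 5 * real n \<and>
      31 * real n + R \<le> s * (\<Sum>e\<in>slots n. light_tilt K y e * (of_bool (x e) - q e))} \<le> exp (- R)"
proof (rule order.trans[OF measure_pmf.finite_measure_mono dyadic_union_bound])
  let ?c = "\<lambda>y e. s * light_tilt K y e"
  show "{x. \<exists>y \<in> PiE {..<n} (\<lambda>_. dyadics 0 B). (\<Sum>i<n. (y i)\<^sup>2) \<le> 5 * real n \<and>
      31 * real n + R \<le> s * (\<Sum>e\<in>slots n. light_tilt K y e * (of_bool (x e) - q e))}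
    \<subseteq> {x. \<exists>y \<in> PiE {..<n} (\<lambda>_. dyadics 0 B). (\<Sum>e\<in>slots n. q e * (exp (?c y e) - 1)) +
      (3 * (\<Sum>i<n. ln \<bar>y i\<bar>) + 3 * real n * (1/8) ^ 0 + R) \<le> (\<Sum>e\<in>slots n. ?c y e * of_bool (x e))}"
  proof safe
    fix x y
    assume y: "y \<in> PiE {..<n} (\<lambda>_. dyadics 0 B)" and N: "(\<Sum>i<n. (y i)\<^sup>2) \<le> 5 * real n"
      and big: "31 * real n + R \<le> s * (\<Sum>e\<in>slots n. light_tilt K y e * (of_bool (x e) - q e))"
    have "(\<Sum>e\<in>slots n. q e * (exp (?c y e) - 1))
        \<le> (\<Sum>e\<in>slots n. q e * ?c y e + (edge_prod y e)\<^sup>2 / real n)"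
    proof (rule sum_mono)
      fix e assume e: "e \<in> slots n"
      have c1: "\<bar>?c y e\<bar> \<le> 1"
        using s K edge_min_max(4)[of y e] by (auto simp: light_tilt_def abs_mult divide_simps)
      have "K * (?c y e)\<^sup>2 \<le> (edge_prod y e)\<^sup>2"
      proof -
        have "s\<^sup>2 = 1" using s by (metis power2_abs one_power2)
        then show ?thesis using K by (auto simp: light_tilt_def power_mult_distrib power_divide)
      qed
      then have "q e * (?c y e)\<^sup>2 \<le> (edge_prod y e)\<^sup>2 / real n"
        using mult_right_mono[OF qK[OF e], of "(?c y e)\<^sup>2"] n
        by (simp add: field_simps)
      moreover have "q e * (exp (?c y e) - 1) \<le> q e * (?c y e + (?c y e)\<^sup>2)"
        using q[OF e] exp_quadratic_bound[OF c1] by (intro mult_left_mono) auto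
      ultimately show "q e * (exp (?c y e) - 1) \<le> q e * ?c y e + (edge_prod y e)\<^sup>2 / real n"
        by (simp add: distrib_left)
    qed
    also have "\<dots> = (\<Sum>e\<in>slots n. q e * ?c y e) + (\<Sum>e\<in>slots n. (edge_prod y e)\<^sup>2) / real n"
      by (simp add: sum.distrib sum_divide_distrib)
    also have "(\<Sum>e\<in>slots n. (edge_prod y e)\<^sup>2) / real n \<le> (25/2) * real n"
    proof -
      have "(\<Sum>e\<in>slots n. (edge_prod y e)\<^sup>2) \<le> (5 * real n)\<^sup>2 / 2"
        using sum_slots_edge_prod_le[of y n] power_mono[OF N, of 2] by (simp add: sum_nonneg)
      then show ?thesis using n by (simp add: field_simps power2_eq_square)
    qed
    finally have "(\<Sum>e\<in>slots n. q e * (exp (?c y e) - 1))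
      \<le> (\<Sum>e\<in>slots n. q e * ?c y e) + (25/2) * real n" by simp
    moreover have "(\<Sum>i<n. ln \<bar>y i\<bar>) \<le> 5 * real n"
      using sum_mono[of "{..<n}" "\<lambda>i. ln \<bar>y i\<bar>" "\<lambda>i. (y i)\<^sup>2"] ln_abs_le_square N by fastforce
    moreover have "s * (\<Sum>e\<in>slots n. light_tilt K y e * (of_bool (x e) - q e))
      = (\<Sum>e\<in>slots n. ?c y e * of_bool (x e)) - (\<Sum>e\<in>slots n. q e * ?c y e)"
      by (simp add: sum_distrib_left sum_subtractf[symmetric] algebra_simps)
    ultimately have "(\<Sum>e\<in>slots n. q e * (exp (?c y e) - 1)) +
      (3 * (\<Sum>i<n. ln \<bar>y i\<bar>) + 3 * real n * (1/8) ^ 0 + R) \<le> (\<Sum>e\<in>slots n. ?c y e * of_bool (x e))"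
      using big by simp
    then show "\<exists>y \<in> PiE {..<n} (\<lambda>_. dyadics 0 B). (\<Sum>e\<in>slots n. q e * (exp (?c y e) - 1)) +
      (3 * (\<Sum>i<n. ln \<bar>y i\<bar>) + 3 * real n * (1/8) ^ 0 + R) \<le> (\<Sum>e\<in>slots n. ?c y e * of_bool (x e))"
      using y by blast
  qed
qed (use q in auto)

section \<open>Heavy pairs, level by level\<close>

text \<open>These are the heavy pairs whose entries differ by a factor of at most
  \<open>sqrt K\<close>. The two inequalities place the ratio
  \<open>edge_max / (edge_min * sqrt K)\<close> between \<open>(1/4) ^ a\<close> and 1, the range of
  \<open>exp_level_bound\<close>.\<close>

definition level_slot :: "real \<Rightarrow> (nat \<Rightarrow> real) \<Rightarrow> nat \<Rightarrow> nat \<times> nat \<Rightarrow> bool" where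
  "level_slot K y a e \<longleftrightarrow> edge_min y e = 2 ^ a \<and> edge_max y e \<le> sqrt K * edge_min y e
    \<and> sqrt K < edge_min y e * edge_max y e"

text \<open>The tilt grows with the level \<open>a\<close>, so that the price of the union bound is divided by \<open>a + 1\<close>;
  with a constant tilt, summing over the levels would cost a factor \<open>ln n\<close>.\<close>

definition level_tilt :: "real \<Rightarrow> nat \<Rightarrow> (nat \<Rightarrow> real) \<Rightarrow> nat \<times> nat \<Rightarrow> real" where
  "level_tilt K a y e =
     (if level_slot K y a e then (real a + 1) * (edge_max y e / (edge_min y e * sqrt K)) else 0)"

definition level_mass :: "nat \<Rightarrow> nat \<Rightarrow> (nat \<Rightarrow> real) \<Rightarrow> real" where
  "level_mass n a y = (\<Sum>e\<in>slots n. if edge_min y e = 2 ^ a then (edge_prod y e)\<^sup>2 else 0)"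

text \<open>Only the upper tail of the uncentred sum is bounded, because heavy pairs are treated
  without cancellation. The exponential of the tilt is linear in the ratio \<open>\<rho>\<close> by
  \<open>exp_level_bound\<close>, so the exponential moment is quadratic in \<open>\<rho>\<close>,
  hence in the product of the entries, and \<open>q e \<le> K / n\<close> turns it into
  \<open>level_mass\<close>.\<close>

lemma level_event:
  fixes q :: "nat \<times> nat \<Rightarrow> real"
  assumes K: "1 \<le> K" and n: "1 \<le> n"
    and q: "\<And>e. e \<in> slots n \<Longrightarrow> 0 \<le> q e \<and> q e \<le> 1"
    and qK: "\<And>e. e \<in> slots n \<Longrightarrow> q e \<le> K / real n"
  shows "measure_pmf.prob (bernoulli_product (slots n) q)
    {x. \<exists>y \<in> PiE {..<n} (\<lambda>_. dyadics a B).
      3 * (real a + 1) * (1/4) ^ a * level_mass n a y / real n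
        + (3 * (\<Sum>i<n. ln \<bar>y i\<bar>) + 3 * real n * (1/8) ^ a + R)
      \<le> (\<Sum>e\<in>slots n. level_tilt K a y e * of_bool (x e))} \<le> exp (- R)"
proof (rule order.trans[OF measure_pmf.finite_measure_mono dyadic_union_bound])
  let ?c = "level_tilt K a"
  have "(\<Sum>e\<in>slots n. q e * (exp (?c y e) - 1))
      \<le> 3 * (real a + 1) * (1/4) ^ a * level_mass n a y / real n" for y
  proof -
    have "(\<Sum>e\<in>slots n. q e * (exp (?c y e) - 1))
      \<le> (\<Sum>e\<in>slots n. 3 * (real a + 1) * (1/4) ^ a / real n * (if edge_min y e = 2 ^ a then (edge_prod y e)\<^sup>2 else 0))"
    proof (rule sum_mono)
      fix e assume e: "e \<in> slots n"
      show "q e * (exp (?c y e) - 1)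
        \<le> 3 * (real a + 1) * (1/4) ^ a / real n * (if edge_min y e = 2 ^ a then (edge_prod y e)\<^sup>2 else 0)"
      proof (cases "level_slot K y a e")
        case False
        then show ?thesis by (simp add: level_tilt_def)
      next
        case True
        define \<rho> where "\<rho> = edge_max y e / (edge_min y e * sqrt K)"
        have l: "edge_min y e = 2 ^ a"
          and h: "edge_max y e \<le> sqrt K * edge_min y e" "sqrt K < edge_min y e * edge_max y e"
          using True by (auto simp: level_slot_def)
        have sK: "1 \<le> sqrt K" using K by simp
        have a4: "(2::real) ^ a * 2 ^ a = 4 ^ a" by (simp add: power_mult_distrib[symmetric])
        have r4: "\<rho> * 4 ^ a = edge_min y e * edge_max y e / sqrt K"
          using sK by (simp add: \<rho>_def l a4[symmetric])
        have "1 \<le> \<rho> * 4 ^ a" using h(2) sK unfolding r4 by (simp add: pos_le_divide_eq)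
        then have r1: "(1/4) ^ a \<le> \<rho>" by (simp add: power_one_over field_simps)
        have r2: "\<rho> \<le> 1"
          using h(1) sK by (simp add: \<rho>_def l pos_divide_le_eq mult.commute)
        have r0: "0 \<le> \<rho>" using r1 by (rule order.trans[rotated]) simp
        have c: "?c y e = (real a + 1) * \<rho>" using True by (simp add: level_tilt_def \<rho>_def)
        \<comment> \<open>This is \<open>1 - c \<le> exp (- c)\<close> multiplied by
          \<open>exp c\<close>.\<close>
        have "exp (?c y e) - 1 \<le> ?c y e * exp (?c y e)"
          using exp_ge_add_one_self[of "- ?c y e"] mult_right_mono[of "1 - ?c y e" "exp (- ?c y e)" "exp (?c y e)"]
          by (simp add: mult_exp_exp algebra_simps)
        also have "\<dots> \<le> ((real a + 1) * \<rho>) * (3 * (\<rho> * 4 ^ a))"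
        proof -
          have "exp (?c y e) \<le> exp 1 * (\<rho> * 4 ^ a)" unfolding c by (rule exp_level_bound[OF r1 r2])
          also have "\<dots> \<le> 3 * (\<rho> * 4 ^ a)"
            using r0 exp_le by (intro mult_right_mono) auto
          finally show ?thesis unfolding c using r0 by (intro mult_left_mono) auto
        qed
        also have "\<dots> = 3 * (real a + 1) * (1/4) ^ a * (\<rho> * 4 ^ a)\<^sup>2"
          by (simp add: power2_eq_square power_one_over)
        also have "(\<rho> * 4 ^ a)\<^sup>2 = (edge_prod y e)\<^sup>2 / K"
          using K edge_min_max(5)[of y e] by (simp add: r4 power_divide)
        finally have *: "exp (?c y e) - 1 \<le> 3 * (real a + 1) * (1/4) ^ a * ((edge_prod y e)\<^sup>2 / K)" .
        have "0 \<le> exp (?c y e) - 1" using r0 by (simp add: c)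
        then have "q e * (exp (?c y e) - 1) \<le> (K / real n) * (3 * (real a + 1) * (1/4) ^ a * ((edge_prod y e)\<^sup>2 / K))"
          using qK[OF e] q[OF e] * K by (intro mult_mono) auto
        then show ?thesis using K l by simp
      qed
    qed
    also have "\<dots> = 3 * (real a + 1) * (1/4) ^ a * level_mass n a y / real n"
      by (simp only: level_mass_def sum_distrib_left sum_divide_distrib times_divide_eq_left)
    finally show ?thesis .
  qed
  note * = this
  show "{x. \<exists>y \<in> PiE {..<n} (\<lambda>_. dyadics a B).
      3 * (real a + 1) * (1/4) ^ a * level_mass n a y / real n
        + (3 * (\<Sum>i<n. ln \<bar>y i\<bar>) + 3 * real n * (1/8) ^ a + R)
      \<le> (\<Sum>e\<in>slots n. level_tilt K a y e * of_bool (x e))}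
    \<subseteq> {x. \<exists>y \<in> PiE {..<n} (\<lambda>_. dyadics a B). (\<Sum>e\<in>slots n. q e * (exp (?c y e) - 1)) +
      (3 * (\<Sum>i<n. ln \<bar>y i\<bar>) + 3 * real n * (1/8) ^ a + R) \<le> (\<Sum>e\<in>slots n. ?c y e * of_bool (x e))}"
    using order.trans[OF add_right_mono[OF *]] by blast
qed (use q in auto)

text \<open>Removing the small entries puts \<open>y\<close> into the smaller family over which the
  union bound at level \<open>a\<close> is cheap. \<open>restrict\<close> provides the
  extensionality that \<open>PiE\<close> demands.\<close>

definition cut_below :: "nat \<Rightarrow> nat \<Rightarrow> (nat \<Rightarrow> real) \<Rightarrow> nat \<Rightarrow> real" where
  "cut_below n a y = restrict (\<lambda>i. if \<bar>y i\<bar> < 2 ^ a then 0 else y i) {..<n}"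

lemma cut_below_mem:
  assumes "y \<in> PiE {..<n} (\<lambda>_. dyadics 0 B)"
  shows "cut_below n a y \<in> PiE {..<n} (\<lambda>_. dyadics a B)"
proof (rule PiE_I)
  fix i assume i: "i \<in> {..<n}"
  with assms have "y i \<in> dyadics 0 B" by auto
  then show "cut_below n a y i \<in> dyadics a B"
    using i by (auto simp: cut_below_def dyadics_def)
qed (auto simp: cut_below_def)

text \<open>If the smaller entry is \<open>2 ^ a\<close> before or after the cut, then both original
  entries have modulus at least \<open>2 ^ a\<close> and survive. Hence quantities attached to level
  \<open>a\<close> do not notice the cut.\<close>

lemma cut_below_slot:
  assumes "e \<in> slots n" "(edge_min (cut_below n a y) e = 2 ^ a) \<or> (edge_min y e = 2 ^ a)"
  shows "cut_below n a y (fst e) = y (fst e)" "cut_below n a y (snd e) = y (snd e)"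
proof -
  have "fst e < n" "snd e < n" using assms(1) by (auto simp: slots_def)
  moreover have "(0::real) < 2 ^ a" by simp
  ultimately have "2 ^ a \<le> \<bar>y (fst e)\<bar>" "2 ^ a \<le> \<bar>y (snd e)\<bar>"
    using assms(2) unfolding edge_min_def cut_below_def min_def
    by (auto split: if_splits)
  then show "cut_below n a y (fst e) = y (fst e)" "cut_below n a y (snd e) = y (snd e)"
    using \<open>fst e < n\<close> \<open>snd e < n\<close> by (auto simp: cut_below_def)
qed

lemma level_tilt_cut_below:
  assumes "e \<in> slots n"
  shows "level_tilt K a (cut_below n a y) e = level_tilt K a y e"
proof (cases "(edge_min (cut_below n a y) e = 2 ^ a) \<or> (edge_min y e = 2 ^ a)")
  case True
  then have "edge_min (cut_below n a y) e = edge_min y e" "edge_max (cut_below n a y) e = edge_max y e"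
    using cut_below_slot[OF assms True] by (simp_all add: edge_min_def edge_max_def)
  then show ?thesis by (simp only: level_tilt_def level_slot_def)
qed (simp add: level_tilt_def level_slot_def)

lemma level_mass_cut_below: "level_mass n a (cut_below n a y) = level_mass n a y"
  unfolding level_mass_def
proof (rule sum.cong[OF refl])
  fix e assume e: "e \<in> slots n"
  show "(if edge_min (cut_below n a y) e = 2 ^ a then (edge_prod (cut_below n a y) e)\<^sup>2 else 0)
    = (if edge_min y e = 2 ^ a then (edge_prod y e)\<^sup>2 else 0)"
  proof (cases "(edge_min (cut_below n a y) e = 2 ^ a) \<or> (edge_min y e = 2 ^ a)")
    case True
    have "edge_min (cut_below n a y) e = edge_min y e"
      using cut_below_slot[OF e True] by (simp add: edge_min_def)
    then show ?thesis using cut_below_slot[OF e True] by simp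
  qed simp
qed

text \<open>The smaller entry of a slot determines its level, so each slot is counted at most
  once.\<close>

lemma sum_level_mass_le: "(\<Sum>a\<le>B. level_mass n a y) \<le> (\<Sum>e\<in>slots n. (edge_prod y e)\<^sup>2)"
proof -
  have "(\<Sum>a\<le>B. level_mass n a y) = (\<Sum>e\<in>slots n. \<Sum>a\<le>B. if edge_min y e = 2 ^ a then (edge_prod y e)\<^sup>2 else 0)"
    unfolding level_mass_def by (rule sum.swap)
  also have "\<dots> \<le> (\<Sum>e\<in>slots n. (edge_prod y e)\<^sup>2)"
  proof (rule sum_mono)
    fix e
    show "(\<Sum>a\<le>B. if edge_min y e = 2 ^ a then (edge_prod y e)\<^sup>2 else 0) \<le> (edge_prod y e)\<^sup>2"
    proof (cases "\<exists>b. edge_min y e = 2 ^ b")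
      case True
      then obtain b where "edge_min y e = 2 ^ b" by blast
      then have "(\<Sum>a\<le>B. if edge_min y e = 2 ^ a then (edge_prod y e)\<^sup>2 else 0)
          = (\<Sum>a\<le>B. if b = a then (edge_prod y e)\<^sup>2 else 0)" by simp
      then show ?thesis by simp
    qed simp
  qed
  finally show ?thesis .
qed

text \<open>An entry of modulus \<open>2 ^ b\<close> is charged at the levels
  \<open>a \<le> b\<close> only, each time by at most \<open>b\<close>. The weights up to
  \<open>b\<close> sum to at most \<open>4 * 4 ^ b / (b + 1)\<close>, which absorbs this factor
  \<open>b\<close>.\<close>

lemma sum_level_ln_le:
  assumes "t \<in> dyadics 0 B"
  shows "(\<Sum>a\<le>B. 4 ^ a / (real a + 1) * (if \<bar>t\<bar> < 2 ^ a then 0 else ln \<bar>t\<bar>)) \<le> 4 * t\<^sup>2"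
  using assms
proof (cases rule: dyadicsE)
  case 1
  then show ?thesis by simp
next
  case (2 b)
  have t2: "t\<^sup>2 = 4 ^ b"
    using arg_cong[OF 2(3), of "\<lambda>x. x\<^sup>2"] by (simp add: power_mult[symmetric] mult.commute[of b 2] power_mult)
  have lnt: "0 \<le> ln \<bar>t\<bar>" "ln \<bar>t\<bar> \<le> real b"
  proof -
    show "0 \<le> ln \<bar>t\<bar>" by (simp add: 2(3))
    have "ln (2::real) \<le> 1" using ln_le_minus_one[of "2::real"] by simp
    then show "ln \<bar>t\<bar> \<le> real b" using mult_left_mono[of "ln (2::real)" 1 "real b"] by (simp add: 2(3) ln_realpow)
  qed
  have "(\<Sum>a\<le>B. 4 ^ a / (real a + 1) * (if \<bar>t\<bar> < 2 ^ a then 0 else ln \<bar>t\<bar>))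
    = (\<Sum>a\<le>B. if a \<le> b then 4 ^ a / (real a + 1) * ln \<bar>t\<bar> else 0)"
    by (rule sum.cong) (auto simp: 2(3))
  also have "\<dots> = (\<Sum>a\<le>b. 4 ^ a / (real a + 1)) * ln \<bar>t\<bar>"
  proof -
    have "{..B} \<inter> {a. a \<le> b} = {..b}" using 2 by auto
    then show ?thesis by (simp add: sum.If_cases sum_distrib_right)
  qed
  also have "\<dots> \<le> (4 * 4 ^ b / (real b + 1)) * real b"
    using sum_power_div_le[of b] lnt by (intro mult_mono sum_nonneg) auto
  also have "\<dots> \<le> 4 * 4 ^ b" by (simp add: divide_simps)
  finally show ?thesis by (simp add: t2)
qed

lemma sum_four_power_le: "(\<Sum>a\<le>B. (4::real) ^ a) \<le> (4/3) * 4 ^ B"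
  by (induction B) auto

lemma sum_half_power_le: "(\<Sum>a\<le>B. (1/2::real) ^ a) \<le> 2"
proof -
  have "(\<Sum>a\<le>B. (1/2::real) ^ a) = 2 - (1/2) ^ B" by (induction B) auto
  then show ?thesis by simp
qed

text \<open>The weights \<open>4 ^ a / (a + 1)\<close> undo the normalization of the level tilts.
  The masses contribute \<open>37.5 n\<close>, the logarithms \<open>60 n\<close>, the normalization
  of the prior \<open>6 n\<close>, and the deviations at most \<open>7 n R\<close>, since
  \<open>4 ^ B \<le> 5 n\<close>.\<close>

lemma level_sum_bound:
  assumes n: "1 \<le> n" and R: "0 \<le> R" and B: "4 ^ B \<le> 5 * real n"
    and level: "\<And>a y. a \<le> B \<Longrightarrow> y \<in> PiE {..<n} (\<lambda>_. dyadics a B) \<Longrightarrow>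
      (\<Sum>e\<in>slots n. level_tilt K a y e * X e) \<le> 3 * (real a + 1) * (1/4) ^ a * level_mass n a y / real n
        + (3 * (\<Sum>i<n. ln \<bar>y i\<bar>) + 3 * real n * (1/8) ^ a + (real a + 1) * R)"
    and y: "y \<in> PiE {..<n} (\<lambda>_. dyadics 0 B)" and N: "(\<Sum>i<n. (y i)\<^sup>2) \<le> 5 * real n"
  shows "(\<Sum>a\<le>B. 4 ^ a / (real a + 1) * (\<Sum>e\<in>slots n. level_tilt K a y e * X e))
    \<le> 104 * real n + 7 * real n * R"
proof -
  let ?L = "\<lambda>a i. if \<bar>y i\<bar> < 2 ^ a then 0 else ln \<bar>y i\<bar>"
  have "(\<Sum>a\<le>B. 4 ^ a / (real a + 1) * (\<Sum>e\<in>slots n. level_tilt K a y e * X e))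
    \<le> (\<Sum>a\<le>B. 3 / real n * level_mass n a y + 3 * (\<Sum>i<n. 4 ^ a / (real a + 1) * ?L a i)
        + 3 * real n * (1/2) ^ a + R * 4 ^ a)"
  proof (rule sum_mono)
    fix a assume "a \<in> {..B}"
    then have "(\<Sum>e\<in>slots n. level_tilt K a (cut_below n a y) e * X e)
      \<le> 3 * (real a + 1) * (1/4) ^ a * level_mass n a (cut_below n a y) / real n
        + (3 * (\<Sum>i<n. ln \<bar>cut_below n a y i\<bar>) + 3 * real n * (1/8) ^ a + (real a + 1) * R)"
      using level cut_below_mem[OF y] by blast
    also have "(\<Sum>e\<in>slots n. level_tilt K a (cut_below n a y) e * X e)
        = (\<Sum>e\<in>slots n. level_tilt K a y e * X e)"
      by (rule sum.cong) (auto simp: level_tilt_cut_below)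
    also have "(\<Sum>i<n. ln \<bar>cut_below n a y i\<bar>) = (\<Sum>i<n. ?L a i)"
      by (rule sum.cong) (auto simp: cut_below_def)
    finally have "4 ^ a / (real a + 1) * (\<Sum>e\<in>slots n. level_tilt K a y e * X e)
      \<le> 4 ^ a / (real a + 1) * (3 * (real a + 1) * (1/4) ^ a * level_mass n a y / real n
        + (3 * (\<Sum>i<n. ?L a i) + 3 * real n * (1/8) ^ a + (real a + 1) * R))"
      by (intro mult_left_mono) (auto simp: level_mass_cut_below)
    also have "\<dots> = 4 ^ a / (real a + 1) * (3 * (real a + 1) * (1/4) ^ a * level_mass n a y / real n)
        + 3 * (4 ^ a / (real a + 1) * (\<Sum>i<n. ?L a i))
        + 4 ^ a / (real a + 1) * (3 * real n * (1/8) ^ a)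
        + 4 ^ a / (real a + 1) * ((real a + 1) * R)"
      by (simp only: distrib_left mult.left_commute add.assoc mult.assoc)
    also have "4 ^ a / (real a + 1) * ((real a + 1) * R) = R * 4 ^ a" by simp
    also have "4 ^ a / (real a + 1) * (3 * (real a + 1) * (1/4) ^ a * level_mass n a y / real n)
        = 3 / real n * level_mass n a y" by (simp add: power_one_over divide_simps)
    also have "4 ^ a / (real a + 1) * (3 * real n * (1/8) ^ a) \<le> 3 * real n * (1/2) ^ a"
    proof -
      have "4 ^ a / (real a + 1) \<le> 4 ^ a" by (simp add: divide_simps)
      then have "4 ^ a / (real a + 1) * (3 * real n * (1/8) ^ a) \<le> 4 ^ a * (3 * real n * (1/8) ^ a)"
        by (intro mult_right_mono) auto
      also have "\<dots> = 3 * real n * (4 * (1/8)) ^ a" by (simp only: power_mult_distrib mult_ac)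
      finally show ?thesis by simp
    qed
    finally show "4 ^ a / (real a + 1) * (\<Sum>e\<in>slots n. level_tilt K a y e * X e)
      \<le> 3 / real n * level_mass n a y + 3 * (\<Sum>i<n. 4 ^ a / (real a + 1) * ?L a i)
        + 3 * real n * (1/2) ^ a + R * 4 ^ a" by (simp add: sum_distrib_left)
  qed
  also have "\<dots> = 3 / real n * (\<Sum>a\<le>B. level_mass n a y)
      + 3 * (\<Sum>a\<le>B. \<Sum>i<n. 4 ^ a / (real a + 1) * ?L a i)
      + 3 * real n * (\<Sum>a\<le>B. (1/2) ^ a) + R * (\<Sum>a\<le>B. 4 ^ a)"
    by (simp only: sum.distrib sum_distrib_left)
  also have "(\<Sum>a\<le>B. \<Sum>i<n. 4 ^ a / (real a + 1) * ?L a i) = (\<Sum>i<n. \<Sum>a\<le>B. 4 ^ a / (real a + 1) * ?L a i)"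
    by (rule sum.swap)
  also have "\<dots> \<le> (\<Sum>i<n. 4 * (y i)\<^sup>2)"
    using y by (intro sum_mono sum_level_ln_le) auto
  also have "\<dots> \<le> 20 * real n" using N by (simp add: sum_distrib_left[symmetric])
  also have "3 / real n * (\<Sum>a\<le>B. level_mass n a y) \<le> 3 / real n * ((5 * real n)\<^sup>2 / 2)"
  proof (rule mult_left_mono)
    have "(\<Sum>a\<le>B. level_mass n a y) \<le> (\<Sum>i<n. (y i)\<^sup>2)\<^sup>2 / 2"
      using sum_level_mass_le sum_slots_edge_prod_le order.trans by blast
    also have "\<dots> \<le> (5 * real n)\<^sup>2 / 2" using power_mono[OF N, of 2] by (simp add: sum_nonneg)
    finally show "(\<Sum>a\<le>B. level_mass n a y) \<le> (5 * real n)\<^sup>2 / 2" .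
  qed simp
  also have "3 / real n * ((5 * real n)\<^sup>2 / 2) = (75/2) * real n"
    using n by (simp add: power2_eq_square)
  also have "3 * real n * (\<Sum>a\<le>B. (1/2) ^ a) \<le> 3 * real n * 2"
    by (intro mult_left_mono sum_half_power_le) auto
  also have "R * (\<Sum>a\<le>B. 4 ^ a) \<le> R * (7 * real n)"
    using sum_four_power_le[of B] B R by (intro mult_left_mono) auto
  finally show ?thesis using n mult.commute[of R "7 * real n"] by linarith
qed

text \<open>A deterministic, slot by slot estimate. Light pairs keep their centring. For heavy pairs
  \<open>X\<close> and \<open>q\<close> are bounded separately: \<open>q\<close> by the squared
  products, and \<open>X\<close> either by its level or by the degree term. Altogether
  \<open>31 + 12.5 + 104 = 147.5\<close> is rounded up to 148.\<close>

lemma dyadic_form_bound: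
  fixes q X :: "nat \<times> nat \<Rightarrow> real"
  assumes K: "1 \<le> K" and n: "1 \<le> n" and R: "0 \<le> R" and B: "4 ^ B \<le> 5 * real n"
    and q: "\<And>e. e \<in> slots n \<Longrightarrow> 0 \<le> q e \<and> q e \<le> K / real n" and X: "\<And>e. 0 \<le> X e"
    and light: "\<And>y. y \<in> PiE {..<n} (\<lambda>_. dyadics 0 B) \<Longrightarrow> (\<Sum>i<n. (y i)\<^sup>2) \<le> 5 * real n \<Longrightarrow>
      s * (\<Sum>e\<in>slots n. light_tilt K y e * (X e - q e)) \<le> 31 * real n + R"
    and level: "\<And>a y. a \<le> B \<Longrightarrow> y \<in> PiE {..<n} (\<lambda>_. dyadics a B) \<Longrightarrow>
      (\<Sum>e\<in>slots n. level_tilt K a y e * X e) \<le> 3 * (real a + 1) * (1/4) ^ a * level_mass n a y / real n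
        + (3 * (\<Sum>i<n. ln \<bar>y i\<bar>) + 3 * real n * (1/8) ^ a + (real a + 1) * R)"
    and y: "y \<in> PiE {..<n} (\<lambda>_. dyadics 0 B)" and N: "(\<Sum>i<n. (y i)\<^sup>2) \<le> 5 * real n"
    and s: "\<bar>s\<bar> = 1"
  shows "s * slot_form n (\<lambda>e. X e - q e) y \<le> sqrt K * (148 * real n + 8 * real n * R)
    + (\<Sum>(i, j)\<in>slots n. X (i, j) * ((y i)\<^sup>2 + (y j)\<^sup>2)) / sqrt K"
proof -
  have sK: "1 \<le> sqrt K" "sqrt K * sqrt K = K" using K by auto
  have "s * slot_form n (\<lambda>e. X e - q e) y = (\<Sum>e\<in>slots n. s * (X e - q e) * edge_prod y e)"
    by (simp add: slot_form_def sum_distrib_left case_prod_beta mult.assoc)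
  also have "\<dots> \<le> (\<Sum>e\<in>slots n. sqrt K * (s * (light_tilt K y e * (X e - q e)))
      + sqrt K / real n * (edge_prod y e)\<^sup>2
      + sqrt K * (\<Sum>a\<le>B. 4 ^ a / (real a + 1) * (level_tilt K a y e * X e))
      + X e * ((y (fst e))\<^sup>2 + (y (snd e))\<^sup>2) / sqrt K)"
  proof (rule sum_mono)
    fix e assume e: "e \<in> slots n"
    have t0: "0 \<le> level_tilt K a y e" for a
      using edge_min_max[of y e] K by (auto simp: level_tilt_def)
    have lev0: "0 \<le> sqrt K * (\<Sum>a\<le>B. 4 ^ a / (real a + 1) * (level_tilt K a y e * X e))"
      using t0 X K by (intro mult_nonneg_nonneg sum_nonneg) auto
    have deg0: "0 \<le> X e * ((y (fst e))\<^sup>2 + (y (snd e))\<^sup>2) / sqrt K" using X K by auto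
    have mean0: "0 \<le> sqrt K / real n * (edge_prod y e)\<^sup>2" using K by auto
    show "s * (X e - q e) * edge_prod y e \<le> sqrt K * (s * (light_tilt K y e * (X e - q e)))
      + sqrt K / real n * (edge_prod y e)\<^sup>2
      + sqrt K * (\<Sum>a\<le>B. 4 ^ a / (real a + 1) * (level_tilt K a y e * X e))
      + X e * ((y (fst e))\<^sup>2 + (y (snd e))\<^sup>2) / sqrt K"
    proof (cases "edge_min y e * edge_max y e \<le> sqrt K")
      case True
      then have "sqrt K * (s * (light_tilt K y e * (X e - q e))) = s * (X e - q e) * edge_prod y e"
        using sK by (simp add: light_tilt_def)
      then show ?thesis using lev0 deg0 mean0 by linarith
    next
      case heavy: False
      then have l0: "light_tilt K y e = 0" by (simp add: light_tilt_def)
      let ?w = "\<bar>edge_prod y e\<bar>"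
      have "s * (X e - q e) * edge_prod y e \<le> \<bar>X e - q e\<bar> * ?w"
        using abs_ge_self[of "s * (X e - q e) * edge_prod y e"] s by (simp add: abs_mult)
      also have "\<dots> \<le> q e * ?w + X e * ?w"
        using X[of e] q[OF e] mult_right_mono[of "\<bar>X e - q e\<bar>" "q e + X e" ?w] by (auto simp: distrib_right)
      \<comment> \<open>A heavy product exceeds \<open>sqrt K\<close>, so one factor
        \<open>sqrt K\<close> of \<open>K / n\<close> may be traded for another factor
        \<open>?w\<close>.\<close>
      also have "q e * ?w \<le> sqrt K / real n * (edge_prod y e)\<^sup>2"
      proof -
        have w: "sqrt K \<le> ?w" using heavy edge_min_max(4)[of y e] by simp
        have "q e * ?w \<le> K / real n * ?w" using q[OF e] by (intro mult_right_mono) auto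
        also have "\<dots> = sqrt K / real n * (sqrt K * ?w)" using sK(2) by simp
        also have "\<dots> \<le> sqrt K / real n * (?w * ?w)"
          using w sK by (intro mult_left_mono mult_right_mono) auto
        finally show ?thesis by (simp add: power2_eq_square)
      qed
      also have "X e * ?w \<le> sqrt K * (\<Sum>a\<le>B. 4 ^ a / (real a + 1) * (level_tilt K a y e * X e))
        + X e * ((y (fst e))\<^sup>2 + (y (snd e))\<^sup>2) / sqrt K"
      proof (cases "edge_max y e \<le> sqrt K * edge_min y e")
        case False
        \<comment> \<open>The entries differ by a factor larger than \<open>sqrt K\<close>, so
          \<open>edge_min * sqrt K\<close> is below \<open>edge_max\<close>, and the larger square
          pays for the pair.\<close>
        have "?w * sqrt K \<le> (edge_max y e)\<^sup>2"
          using False edge_min_max[of y e] mult_right_mono[of "sqrt K * edge_min y e" "edge_max y e" "edge_max y e"]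
          by (simp add: power2_eq_square mult_ac)
        also have "(edge_max y e)\<^sup>2 \<le> (y (fst e))\<^sup>2 + (y (snd e))\<^sup>2"
          by (auto simp: edge_max_def max_def)
        finally have "?w \<le> ((y (fst e))\<^sup>2 + (y (snd e))\<^sup>2) / sqrt K"
          using sK by (simp add: pos_le_divide_eq)
        then have "X e * ?w \<le> X e * (((y (fst e))\<^sup>2 + (y (snd e))\<^sup>2) / sqrt K)"
          using X by (intro mult_left_mono) auto
        then show ?thesis using lev0 by simp
      next
        case True
        have "fst e < n" "snd e < n" using e by (auto simp: slots_def)
        then have yl: "y (fst e) \<in> dyadics 0 B" "y (snd e) \<in> dyadics 0 B" using y by auto
        have "edge_min y e \<noteq> 0" using heavy sK by auto
        then obtain a where a: "a \<le> B" "edge_min y e = 2 ^ a"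
          using yl by (auto elim!: dyadicsE simp: edge_min_def min_def split: if_splits)
        have "level_slot K y a e" using True heavy a by (simp add: level_slot_def)
        \<comment> \<open>As \<open>4 ^ a\<close> is the square of the smaller entry, the weight
          turns the tilt back into the product of the two entries.\<close>
        then have "sqrt K * (4 ^ a / (real a + 1) * (level_tilt K a y e * X e)) = X e * ?w"
        proof -
          have "(4::real) ^ a = edge_min y e * edge_min y e" by (simp add: a power_mult_distrib[symmetric])
          then show ?thesis
            using \<open>level_slot K y a e\<close> sK \<open>edge_min y e \<noteq> 0\<close> edge_min_max(4)[of y e]
            by (simp add: level_tilt_def)
        qed
        moreover have "sqrt K * (4 ^ a / (real a + 1) * (level_tilt K a y e * X e))
            \<le> sqrt K * (\<Sum>a\<le>B. 4 ^ a / (real a + 1) * (level_tilt K a y e * X e))"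
          using a t0 X K by (intro mult_left_mono member_le_sum) auto
        ultimately have "X e * ?w \<le> sqrt K * (\<Sum>a\<le>B. 4 ^ a / (real a + 1) * (level_tilt K a y e * X e))"
          by linarith
        then show ?thesis using deg0 by linarith
      qed
      finally show ?thesis using l0 by simp
    qed
  qed
  also have "\<dots> = sqrt K * (s * (\<Sum>e\<in>slots n. light_tilt K y e * (X e - q e)))
      + sqrt K / real n * (\<Sum>e\<in>slots n. (edge_prod y e)\<^sup>2)
      + sqrt K * (\<Sum>a\<le>B. 4 ^ a / (real a + 1) * (\<Sum>e\<in>slots n. level_tilt K a y e * X e))
      + (\<Sum>e\<in>slots n. X e * ((y (fst e))\<^sup>2 + (y (snd e))\<^sup>2)) / sqrt K"
  proof -
    have "(\<Sum>e\<in>slots n. \<Sum>a\<le>B. 4 ^ a / (real a + 1) * (level_tilt K a y e * X e))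
      = (\<Sum>a\<le>B. 4 ^ a / (real a + 1) * (\<Sum>e\<in>slots n. level_tilt K a y e * X e))"
      by (subst sum.swap) (simp only: sum_distrib_left)
    then show ?thesis
      by (simp only: sum.distrib sum_distrib_left[symmetric] sum_divide_distrib[symmetric])
  qed
  also have "\<dots> \<le> sqrt K * (31 * real n + R) + sqrt K / real n * ((5 * real n)\<^sup>2 / 2)
      + sqrt K * (104 * real n + 7 * real n * R)
      + (\<Sum>e\<in>slots n. X e * ((y (fst e))\<^sup>2 + (y (snd e))\<^sup>2)) / sqrt K"
  proof -
    have "(\<Sum>e\<in>slots n. (edge_prod y e)\<^sup>2) \<le> (5 * real n)\<^sup>2 / 2"
      using sum_slots_edge_prod_le[of y n] power_mono[OF N, of 2] by (simp add: sum_nonneg)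
    then show ?thesis
      using sK light[OF y N] level_sum_bound[OF n R B level y N]
      by (intro add_mono mult_left_mono order.refl) auto
  qed
  also have "sqrt K / real n * ((5 * real n)\<^sup>2 / 2) = sqrt K * ((25/2) * real n)"
    using n by (simp add: power2_eq_square)
  also have "sqrt K * (31 * real n + R) + sqrt K * ((25/2) * real n) + sqrt K * (104 * real n + 7 * real n * R)
      = sqrt K * (147.5 * real n + R + 7 * real n * R)" by (simp add: algebra_simps)
  also have "\<dots> \<le> sqrt K * (148 * real n + 8 * real n * R)"
    using sK n R mult_left_mono[of 1 "real n" R] by (intro mult_left_mono) auto
  finally show ?thesis by (simp add: case_prod_beta)
qed

section \<open>The quadratic form of the centred adjacency matrix\<close>

definition edge_energy :: "nat \<Rightarrow> (nat \<times> nat \<Rightarrow> real) \<Rightarrow> (nat \<Rightarrow> real) \<Rightarrow> real" where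
  "edge_energy n X z = (\<Sum>(i, j)\<in>slots n. X (i, j) * ((z i)\<^sup>2 + (z j)\<^sup>2))"

lemma slot_form_scale: "slot_form n m (\<lambda>i. c * z i) = c\<^sup>2 * slot_form n m z"
  by (simp add: slot_form_def sum_distrib_left case_prod_beta power2_eq_square mult_ac)

lemma edge_energy_scale: "edge_energy n X (\<lambda>i. c * z i) = c\<^sup>2 * edge_energy n X z"
  by (simp add: edge_energy_def sum_distrib_left case_prod_beta power_mult_distrib algebra_simps)

text \<open>After scaling to squared norm at most \<open>n\<close>, the vector is enclosed in a box
  with dyadic vertices of squared norm at most \<open>5 n\<close>. Returning from a vertex to
  \<open>z\<close> costs a factor 4 in the energy and twice the total of \<open>X\<close>; hence
  \<open>148 + 63 = 211\<close> and \<open>8 + 2 = 10\<close>.\<close>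

lemma form_bound:
  fixes q X :: "nat \<times> nat \<Rightarrow> real"
  assumes K: "1 \<le> K" and n: "1 \<le> n" and R: "0 \<le> R"
    and B: "4 ^ B \<le> 5 * real n" "5 * real n < 4 ^ Suc B"
    and q: "\<And>e. e \<in> slots n \<Longrightarrow> 0 \<le> q e \<and> q e \<le> K / real n" and X: "\<And>e. 0 \<le> X e"
    and light: "\<And>s y. \<bar>s\<bar> = 1 \<Longrightarrow> y \<in> PiE {..<n} (\<lambda>_. dyadics 0 B) \<Longrightarrow> (\<Sum>i<n. (y i)\<^sup>2) \<le> 5 * real n \<Longrightarrow>
      s * (\<Sum>e\<in>slots n. light_tilt K y e * (X e - q e)) \<le> 31 * real n + R"
    and level: "\<And>a y. a \<le> B \<Longrightarrow> y \<in> PiE {..<n} (\<lambda>_. dyadics a B) \<Longrightarrow>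
      (\<Sum>e\<in>slots n. level_tilt K a y e * X e) \<le> 3 * (real a + 1) * (1/4) ^ a * level_mass n a y / real n
        + (3 * (\<Sum>i<n. ln \<bar>y i\<bar>) + 3 * real n * (1/8) ^ a + (real a + 1) * R)"
  shows "\<bar>slot_form n (\<lambda>e. X e - q e) z\<bar>
    \<le> sqrt K * (211 + 10 * R) * (\<Sum>i<n. (z i)\<^sup>2) + 4 / sqrt K * edge_energy n X z"
proof -
  have sK: "1 \<le> sqrt K" "sqrt K * sqrt K = K" using K by auto
  \<comment> \<open>The total of \<open>X\<close> is controlled by the light bound at the all-ones
    vector, all of whose pairs are light because \<open>1 \<le> sqrt K\<close>.\<close>
  have total: "2 * (\<Sum>e\<in>slots n. X e) / sqrt K \<le> sqrt K * (63 * real n + 2 * R)"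
  proof -
    let ?one = "restrict (\<lambda>_. 1) {..<n} :: nat \<Rightarrow> real"
    have "(1::real) \<in> dyadics 0 B" by (auto simp: dyadics_def intro!: image_eqI[of _ _ 0])
    then have "?one \<in> PiE {..<n} (\<lambda>_. dyadics 0 B)" by auto
    from light[OF _ this, of 1] have "(\<Sum>e\<in>slots n. light_tilt K ?one e * (X e - q e)) \<le> 31 * real n + R"
      by simp
    also have "(\<Sum>e\<in>slots n. light_tilt K ?one e * (X e - q e)) = (\<Sum>e\<in>slots n. (X e - q e) / sqrt K)"
    proof (rule sum.cong[OF refl])
      fix e assume "e \<in> slots n"
      then have "?one (fst e) = 1" "?one (snd e) = 1" by (auto simp: slots_def)
      then show "light_tilt K ?one e * (X e - q e) = (X e - q e) / sqrt K"
        using sK by (simp add: light_tilt_def edge_min_def edge_max_def)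
    qed
    finally have "(\<Sum>e\<in>slots n. X e) / sqrt K \<le> 31 * real n + R + (\<Sum>e\<in>slots n. q e) / sqrt K"
      by (simp add: sum_subtractf diff_divide_distrib sum_divide_distrib)
    also have "(\<Sum>e\<in>slots n. q e) \<le> K * real n / 2"
    proof -
      have "(\<Sum>e\<in>slots n. q e) \<le> (\<Sum>e\<in>slots n. K / real n * 1)" using q by (intro sum_mono) auto
      also have "\<dots> = K / real n * (\<Sum>e\<in>slots n. 1)" by (simp only: sum_distrib_left)
      also have "\<dots> \<le> K / real n * ((real n)\<^sup>2 / 2)"
        using sum_slots_mult_le[of "\<lambda>_. 1" n] K by (intro mult_left_mono) (auto simp: case_prod_beta)
      finally show ?thesis using n by (simp add: power2_eq_square)
    qed
    also have "K * real n / 2 / sqrt K = sqrt K * real n / 2"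
      using sK K by (simp add: field_simps)
    finally have "2 * (\<Sum>e\<in>slots n. X e) / sqrt K \<le> 1 * (62 * real n + 2 * R) + sqrt K * real n"
      using sK by (simp add: divide_right_mono)
    also have "\<dots> \<le> sqrt K * (62 * real n + 2 * R) + sqrt K * real n"
      using sK R by (intro add_right_mono mult_right_mono) auto
    finally show ?thesis by (simp add: algebra_simps)
  qed
  have unit: "s * slot_form n (\<lambda>e. X e - q e) z
      \<le> sqrt K * (211 + 10 * R) * real n + 4 / sqrt K * edge_energy n X z"
    if s: "\<bar>s\<bar> = 1" and z: "(\<Sum>i<n. (z i)\<^sup>2) \<le> real n" for s z
  proof -
    have "\<forall>i. \<exists>l u. i < n \<longrightarrow> l \<in> dyadics 0 B \<and> u \<in> dyadics 0 B \<and> l \<le> z i \<and> z i \<le> u \<and>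
      l\<^sup>2 \<le> 4 * (z i)\<^sup>2 + 1 \<and> u\<^sup>2 \<le> 4 * (z i)\<^sup>2 + 1"
    proof
      fix i
      show "\<exists>l u. i < n \<longrightarrow> l \<in> dyadics 0 B \<and> u \<in> dyadics 0 B \<and> l \<le> z i \<and> z i \<le> u \<and>
        l\<^sup>2 \<le> 4 * (z i)\<^sup>2 + 1 \<and> u\<^sup>2 \<le> 4 * (z i)\<^sup>2 + 1"
      proof (cases "i < n")
        case True
        then have "(z i)\<^sup>2 \<le> (\<Sum>i<n. (z i)\<^sup>2)" by (intro member_le_sum) auto
        then have "(z i)\<^sup>2 \<le> real n" using z by linarith
        then show ?thesis by (rule dyadic_bracket[OF _ B(2)]) blast
      qed blast
    qed
    then obtain l u where lu: "\<And>i. i < n \<Longrightarrow> l i \<in> dyadics 0 B \<and> u i \<in> dyadics 0 B \<and> l i \<le> z i \<and> z i \<le> u i \<and>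
        (l i)\<^sup>2 \<le> 4 * (z i)\<^sup>2 + 1 \<and> (u i)\<^sup>2 \<le> 4 * (z i)\<^sup>2 + 1"
      by metis
    show ?thesis
    proof (rule multiaffine_le_vertices[where f = "\<lambda>z. s * slot_form n (\<lambda>e. X e - q e) z" and l = l and u = u])
      fix w i
      obtain \<alpha> \<beta> where "\<And>t. slot_form n (\<lambda>e. X e - q e) (w(i := t)) = \<alpha> + \<beta> * t"
        using slot_form_affine by blast
      then show "\<exists>\<alpha> \<beta>. \<forall>t. s * slot_form n (\<lambda>e. X e - q e) (w(i := t)) = \<alpha> + \<beta> * t"
        by (intro exI[of _ "s * \<alpha>"] exI[of _ "s * \<beta>"]) (simp add: algebra_simps)
    next
      fix y assume y: "\<And>i. i < n \<Longrightarrow> y i \<in> {l i, u i}"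
      define y' where "y' = restrict y {..<n}"
      have y'i: "y' i = y i" if "i < n" for i using that by (simp add: y'_def)
      have y'L: "y' \<in> PiE {..<n} (\<lambda>_. dyadics 0 B)"
      proof (rule PiE_I)
        fix i assume i: "i \<in> {..<n}"
        then have "y i = l i \<or> y i = u i" "l i \<in> dyadics 0 B" "u i \<in> dyadics 0 B" using y lu by auto
        then show "y' i \<in> dyadics 0 B" using i y'i by auto
      qed (simp add: y'_def)
      have ysq: "(y' i)\<^sup>2 \<le> 4 * (z i)\<^sup>2 + 1" if "i < n" for i using y[OF that] lu[OF that] y'i[OF that] by auto
      have "(\<Sum>i<n. (y' i)\<^sup>2) \<le> (\<Sum>i<n. 4 * (z i)\<^sup>2 + 1)" using ysq by (intro sum_mono) auto
      also have "\<dots> = 4 * (\<Sum>i<n. (z i)\<^sup>2) + real n" by (simp add: sum.distrib sum_distrib_left)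
      finally have N: "(\<Sum>i<n. (y' i)\<^sup>2) \<le> 5 * real n" using z by linarith
      have "slot_form n (\<lambda>e. X e - q e) y = slot_form n (\<lambda>e. X e - q e) y'"
        by (rule slot_form_cong) (simp add: y'i)
      then have "s * slot_form n (\<lambda>e. X e - q e) y \<le> sqrt K * (148 * real n + 8 * real n * R)
        + (\<Sum>(i, j)\<in>slots n. X (i, j) * ((y' i)\<^sup>2 + (y' j)\<^sup>2)) / sqrt K"
        using dyadic_form_bound[OF K n R B(1) q X light[OF s] level y'L N s] by simp
      also have "(\<Sum>(i, j)\<in>slots n. X (i, j) * ((y' i)\<^sup>2 + (y' j)\<^sup>2))
        \<le> (\<Sum>(i, j)\<in>slots n. 4 * (X (i, j) * ((z i)\<^sup>2 + (z j)\<^sup>2)) + 2 * X (i, j))"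
      proof (rule sum_mono, clarify)
        fix i j assume "(i, j) \<in> slots n"
        then have "i < n" "j < n" by (auto simp: slots_def)
        then have "(y' i)\<^sup>2 + (y' j)\<^sup>2 \<le> 4 * (z i)\<^sup>2 + 4 * (z j)\<^sup>2 + 2" using ysq[of i] ysq[of j] by linarith
        then have "X (i, j) * ((y' i)\<^sup>2 + (y' j)\<^sup>2) \<le> X (i, j) * (4 * (z i)\<^sup>2 + 4 * (z j)\<^sup>2 + 2)"
          using X by (intro mult_left_mono) auto
        then show "X (i, j) * ((y' i)\<^sup>2 + (y' j)\<^sup>2) \<le> 4 * (X (i, j) * ((z i)\<^sup>2 + (z j)\<^sup>2)) + 2 * X (i, j)"
          by (simp add: algebra_simps)
      qed
      also have "\<dots> = 4 * edge_energy n X z + 2 * (\<Sum>e\<in>slots n. X e)"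
        by (simp add: edge_energy_def sum.distrib sum_distrib_left case_prod_beta)
      finally have "s * slot_form n (\<lambda>e. X e - q e) y \<le> sqrt K * (148 * real n + 8 * real n * R)
        + (4 * edge_energy n X z + 2 * (\<Sum>e\<in>slots n. X e)) / sqrt K"
        using sK by (simp add: divide_right_mono)
      also have "\<dots> = sqrt K * (148 * real n + 8 * real n * R)
        + 4 / sqrt K * edge_energy n X z + 2 * (\<Sum>e\<in>slots n. X e) / sqrt K"
        by (simp add: add_divide_distrib)
      also have "\<dots> \<le> sqrt K * (148 * real n + 8 * real n * R)
        + 4 / sqrt K * edge_energy n X z + sqrt K * (63 * real n + 2 * R)"
        using total by simp
      also have "\<dots> = sqrt K * (211 * real n + 8 * real n * R + 2 * R) + 4 / sqrt K * edge_energy n X z"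
        by (simp add: algebra_simps)
      also have "\<dots> \<le> sqrt K * ((211 + 10 * R) * real n) + 4 / sqrt K * edge_energy n X z"
      proof -
        have "R \<le> R * real n" using n R mult_left_mono[of 1 "real n" R] by simp
        then have "211 * real n + 8 * real n * R + 2 * R \<le> (211 + 10 * R) * real n"
          by (simp add: algebra_simps)
        then show ?thesis using sK by (intro add_right_mono mult_left_mono) auto
      qed
      finally show "s * slot_form n (\<lambda>e. X e - q e) y
        \<le> sqrt K * (211 + 10 * R) * real n + 4 / sqrt K * edge_energy n X z"
        by (simp only: mult.assoc)
    qed (use lu in auto)
  qed
  have *: "s * slot_form n (\<lambda>e. X e - q e) z
    \<le> sqrt K * (211 + 10 * R) * (\<Sum>i<n. (z i)\<^sup>2) + 4 / sqrt K * edge_energy n X z" if s: "\<bar>s\<bar> = 1" for s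
  proof (cases "(\<Sum>i<n. (z i)\<^sup>2) = 0")
    case True
    then have "z i = 0" if "i < n" for i using that by (simp add: sum_nonneg_eq_0_iff)
    then have "slot_form n (\<lambda>e. X e - q e) z = slot_form n (\<lambda>e. X e - q e) (\<lambda>_. 0)"
      by (intro slot_form_cong) auto
    then have "slot_form n (\<lambda>e. X e - q e) z = 0" by (simp add: slot_form_def case_prod_beta)
    moreover have "0 \<le> edge_energy n X z"
      using X by (auto simp: edge_energy_def intro!: sum_nonneg)
    ultimately show ?thesis using True sK by simp
  next
    case False
    define S where "S = (\<Sum>i<n. (z i)\<^sup>2)"
    have S: "0 < S" using False sum_nonneg[of "{..<n}" "\<lambda>i. (z i)\<^sup>2"] unfolding S_def by simp
    \<comment> \<open>Both sides are homogeneous of degree 2, so \<open>z\<close> may be scaled to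
      squared norm exactly \<open>n\<close>.\<close>
    define c where "c = sqrt (real n / S)"
    have c2: "c\<^sup>2 = real n / S" using S by (simp add: c_def)
    have "(\<Sum>i<n. (c * z i)\<^sup>2) = c\<^sup>2 * S"
      by (simp only: power_mult_distrib sum_distrib_left S_def)
    then have cS: "(\<Sum>i<n. (c * z i)\<^sup>2) = real n" using S c2 by simp
    have "c\<^sup>2 * (s * slot_form n (\<lambda>e. X e - q e) z)
      \<le> sqrt K * (211 + 10 * R) * real n + c\<^sup>2 * (4 / sqrt K * edge_energy n X z)"
      using unit[OF s eq_refl[OF cS]] by (simp add: slot_form_scale edge_energy_scale mult_ac)
    also have "real n = c\<^sup>2 * S" using S c2 by simp
    finally have "c\<^sup>2 * (s * slot_form n (\<lambda>e. X e - q e) z)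
      \<le> c\<^sup>2 * (sqrt K * (211 + 10 * R) * S + 4 / sqrt K * edge_energy n X z)"
      by (simp only: distrib_left mult_ac)
    moreover have "0 < c\<^sup>2" using S n c2 by simp
    ultimately show ?thesis unfolding S_def by (rule mult_left_le_imp_le)
  qed
  show ?thesis using *[of 1] *[of "-1"] by simp
qed

text \<open>The two signs of the light event fail with probability at most \<open>exp (- R)\<close>
  each. Level \<open>a\<close> is used with deviation \<open>(a + 1) R\<close>, and all levels
  together cost at most \<open>2 * exp (- R)\<close>.\<close>

lemma form_event:
  fixes q :: "nat \<times> nat \<Rightarrow> real"
  assumes K: "1 \<le> K" and n: "1 \<le> n" and R: "1 \<le> R"
    and q: "\<And>e. e \<in> slots n \<Longrightarrow> 0 \<le> q e \<and> q e \<le> 1"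
    and qK: "\<And>e. e \<in> slots n \<Longrightarrow> q e \<le> K / real n"
  shows "measure_pmf.prob (bernoulli_product (slots n) q)
    {x. \<not> (\<forall>z. \<bar>slot_form n (\<lambda>e. of_bool (x e) - q e) z\<bar>
      \<le> sqrt K * (211 + 10 * R) * (\<Sum>i<n. (z i)\<^sup>2) + 4 / sqrt K * edge_energy n (\<lambda>e. of_bool (x e)) z)}
    \<le> 4 * exp (- R)"
proof -
  let ?P = "bernoulli_product (slots n) q"
  \<comment> \<open>\<open>2 ^ B\<close> is the largest power of two whose square is at most
    \<open>5 n\<close>, the bound on the squared norm of a rounded vector.\<close>
  obtain B where "4 ^ B \<le> 5 * n" "5 * n < 4 ^ (B + 1)" using ex_power_ivl1[of 4 "5 * n"] n by auto
  then have "real (4 ^ B) \<le> real (5 * n)" "real (5 * n) < real (4 ^ Suc B)"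
    by (simp_all only: of_nat_le_iff of_nat_less_iff Suc_eq_plus1)
  then have B: "4 ^ B \<le> 5 * real n" "5 * real n < 4 ^ Suc B" by auto
  define L where "L s = {x. \<exists>y \<in> PiE {..<n} (\<lambda>_. dyadics 0 B). (\<Sum>i<n. (y i)\<^sup>2) \<le> 5 * real n \<and>
      31 * real n + R \<le> s * (\<Sum>e\<in>slots n. light_tilt K y e * (of_bool (x e) - q e))}" for s
  define M where "M a = {x. \<exists>y \<in> PiE {..<n} (\<lambda>_. dyadics a B).
      3 * (real a + 1) * (1/4) ^ a * level_mass n a y / real n
        + (3 * (\<Sum>i<n. ln \<bar>y i\<bar>) + 3 * real n * (1/8) ^ a + (real a + 1) * R)
      \<le> (\<Sum>e\<in>slots n. level_tilt K a y e * of_bool (x e))}" for a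
  have "{x. \<not> (\<forall>z. \<bar>slot_form n (\<lambda>e. of_bool (x e) - q e) z\<bar>
      \<le> sqrt K * (211 + 10 * R) * (\<Sum>i<n. (z i)\<^sup>2) + 4 / sqrt K * edge_energy n (\<lambda>e. of_bool (x e)) z)}
    \<subseteq> (L 1 \<union> L (-1)) \<union> (\<Union>a\<le>B. M a)"
  proof (rule subsetI, rule ccontr)
    fix x assume bad: "x \<in> {x. \<not> (\<forall>z. \<bar>slot_form n (\<lambda>e. of_bool (x e) - q e) z\<bar>
      \<le> sqrt K * (211 + 10 * R) * (\<Sum>i<n. (z i)\<^sup>2) + 4 / sqrt K * edge_energy n (\<lambda>e. of_bool (x e)) z)}"
      and good: "x \<notin> (L 1 \<union> L (-1)) \<union> (\<Union>a\<le>B. M a)"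
    have "\<bar>slot_form n (\<lambda>e. of_bool (x e) - q e) z\<bar>
      \<le> sqrt K * (211 + 10 * R) * (\<Sum>i<n. (z i)\<^sup>2) + 4 / sqrt K * edge_energy n (\<lambda>e. of_bool (x e)) z" for z
    proof (rule form_bound[OF K n _ B])
      fix s :: real and y
      assume s: "\<bar>s\<bar> = 1" and y: "y \<in> PiE {..<n} (\<lambda>_. dyadics 0 B)" "(\<Sum>i<n. (y i)\<^sup>2) \<le> 5 * real n"
      have "x \<notin> L s" using good s by (auto simp: abs_if split: if_splits)
      then show "s * (\<Sum>e\<in>slots n. light_tilt K y e * (of_bool (x e) - q e)) \<le> 31 * real n + R"
        using y unfolding L_def mem_Collect_eq by (blast intro: less_imp_le[OF not_le_imp_less])
    next
      fix a y assume a: "a \<le> B" and y: "y \<in> PiE {..<n} (\<lambda>_. dyadics a B)"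
      have "x \<notin> M a" using good a by auto
      then have "\<not> 3 * (real a + 1) * (1/4) ^ a * level_mass n a y / real n
        + (3 * (\<Sum>i<n. ln \<bar>y i\<bar>) + 3 * real n * (1/8) ^ a + (real a + 1) * R)
        \<le> (\<Sum>e\<in>slots n. level_tilt K a y e * of_bool (x e))"
        using y unfolding M_def mem_Collect_eq by blast
      then show "(\<Sum>e\<in>slots n. level_tilt K a y e * of_bool (x e))
        \<le> 3 * (real a + 1) * (1/4) ^ a * level_mass n a y / real n
        + (3 * (\<Sum>i<n. ln \<bar>y i\<bar>) + 3 * real n * (1/8) ^ a + (real a + 1) * R)"
        by (rule less_imp_le[OF not_le_imp_less])
    qed (use R q qK in auto)
    then show False using bad by blast
  qed
  then have "measure_pmf.prob ?P {x. \<not> (\<forall>z. \<bar>slot_form n (\<lambda>e. of_bool (x e) - q e) z\<bar>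
      \<le> sqrt K * (211 + 10 * R) * (\<Sum>i<n. (z i)\<^sup>2) + 4 / sqrt K * edge_energy n (\<lambda>e. of_bool (x e)) z)}
    \<le> measure_pmf.prob ?P ((L 1 \<union> L (-1)) \<union> (\<Union>a\<le>B. M a))"
    by (intro measure_pmf.finite_measure_mono) auto
  also have "\<dots> \<le> measure_pmf.prob ?P (L 1) + measure_pmf.prob ?P (L (-1)) + (\<Sum>a\<le>B. measure_pmf.prob ?P (M a))"
  proof -
    have "measure_pmf.prob ?P ((L 1 \<union> L (-1)) \<union> (\<Union>a\<le>B. M a))
      \<le> measure_pmf.prob ?P (L 1 \<union> L (-1)) + measure_pmf.prob ?P (\<Union>a\<le>B. M a)"
      by (rule measure_Un_le) auto
    moreover have "measure_pmf.prob ?P (L 1 \<union> L (-1)) \<le> measure_pmf.prob ?P (L 1) + measure_pmf.prob ?P (L (-1))"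
      by (rule measure_Un_le) auto
    moreover have "measure_pmf.prob ?P (\<Union>a\<le>B. M a) \<le> (\<Sum>a\<le>B. measure_pmf.prob ?P (M a))"
      by (rule measure_pmf.finite_measure_subadditive_finite) auto
    ultimately show ?thesis by linarith
  qed
  also have "measure_pmf.prob ?P (L 1) \<le> exp (- R)"
    unfolding L_def by (intro light_event K n q qK) auto
  also have "measure_pmf.prob ?P (L (-1)) \<le> exp (- R)"
    unfolding L_def by (intro light_event K n q qK) auto
  also have "(\<Sum>a\<le>B. measure_pmf.prob ?P (M a)) \<le> (\<Sum>a\<le>B. exp (- R) * (1/2) ^ a)"
  proof (rule sum_mono)
    fix a
    \<comment> \<open>With \<open>R \<ge> 1\<close> the failure probabilities of the levels decay at
      least like powers of one half.\<close>
    have "exp (- R) \<le> 1/2"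
    proof -
      have "2 \<le> exp R" using exp_ge_add_one_self[of R] R by linarith
      then show ?thesis by (simp add: exp_minus field_simps)
    qed
    then have "exp (- R) ^ a \<le> (1/2) ^ a" by (intro power_mono) auto
    then have "exp (- R) * exp (- R) ^ a \<le> exp (- R) * (1/2) ^ a" by (intro mult_left_mono) auto
    moreover have "exp (- ((real a + 1) * R)) = exp (- R) * exp (- R) ^ a"
      by (simp add: exp_of_nat_mult[symmetric] mult_exp_exp algebra_simps)
    moreover have "measure_pmf.prob ?P (M a) \<le> exp (- ((real a + 1) * R))"
      unfolding M_def by (intro level_event K n q qK)
    ultimately show "measure_pmf.prob ?P (M a) \<le> exp (- R) * (1/2) ^ a" by linarith
  qed
  also have "\<dots> = exp (- R) * (\<Sum>a\<le>B. (1/2) ^ a)" by (simp only: sum_distrib_left)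
  also have "\<dots> \<le> exp (- R) * 2" by (intro mult_left_mono sum_half_power_le) auto
  finally show ?thesis by simp
qed

section \<open>Fluctuations of the degrees\<close>

definition degree_dev :: "nat \<Rightarrow> (nat \<times> nat \<Rightarrow> real) \<Rightarrow> (nat \<times> nat \<Rightarrow> bool) \<Rightarrow> nat \<Rightarrow> real" where
  "degree_dev n q x i = (\<Sum>e\<in>slots n. if fst e = i \<or> snd e = i then of_bool (x e) - q e else 0)"

text \<open>The tilt \<open>1 / sqrt E\<close> is at most 1. After centring only the quadratic terms
  remain, and they add up to the mean degree divided by \<open>E\<close>, hence to at most
  1.\<close>

lemma degree_dev_mgf:
  fixes q :: "nat \<times> nat \<Rightarrow> real"
  assumes q: "\<And>e. e \<in> slots n \<Longrightarrow> 0 \<le> q e \<and> q e \<le> 1"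
    and E: "1 \<le> E" "(\<Sum>e\<in>slots n. if fst e = i \<or> snd e = i then q e else 0) \<le> E" and s: "\<bar>s\<bar> = 1"
  shows "measure_pmf.expectation (bernoulli_product (slots n) q) (\<lambda>x. exp (s * degree_dev n q x i / sqrt E))
    \<le> exp 1"
proof -
  define c where "c e = (if fst e = i \<or> snd e = i then s / sqrt E else 0)" for e :: "nat \<times> nat"
  have s2: "s\<^sup>2 = 1" using s by (metis power2_abs one_power2)
  have "s * degree_dev n q x i / sqrt E = (\<Sum>e\<in>slots n. c e * of_bool (x e)) + - (\<Sum>e\<in>slots n. q e * c e)" for x
    unfolding degree_dev_def sum_distrib_left sum_divide_distrib sum_negf[symmetric] sum.distrib[symmetric]
    by (rule sum.cong) (auto simp: c_def algebra_simps diff_divide_distrib)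
  then have "measure_pmf.expectation (bernoulli_product (slots n) q) (\<lambda>x. exp (s * degree_dev n q x i / sqrt E))
    = measure_pmf.expectation (bernoulli_product (slots n) q) (\<lambda>x. exp (\<Sum>e\<in>slots n. c e * of_bool (x e)))
      * exp (- (\<Sum>e\<in>slots n. q e * c e))"
    by (simp only: exp_add integral_mult_left_zero)
  also have "\<dots> \<le> exp (\<Sum>e\<in>slots n. q e * (exp (c e) - 1)) * exp (- (\<Sum>e\<in>slots n. q e * c e))"
    by (intro mult_right_mono expectation_exp_le q) auto
  also have "\<dots> = exp ((\<Sum>e\<in>slots n. q e * (exp (c e) - 1)) - (\<Sum>e\<in>slots n. q e * c e))"
    by (simp add: mult_exp_exp)
  also have "(\<Sum>e\<in>slots n. q e * (exp (c e) - 1)) - (\<Sum>e\<in>slots n. q e * c e) \<le> 1"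
  proof -
    have "(\<Sum>e\<in>slots n. q e * (exp (c e) - 1)) - (\<Sum>e\<in>slots n. q e * c e)
      \<le> (\<Sum>e\<in>slots n. (if fst e = i \<or> snd e = i then q e else 0) / E)"
      unfolding sum_subtractf[symmetric]
    proof (rule sum_mono)
      fix e assume e: "e \<in> slots n"
      have "\<bar>c e\<bar> \<le> 1" using E s by (auto simp: c_def)
      then have "q e * (exp (c e) - 1) \<le> q e * (c e + (c e)\<^sup>2)"
        using q[OF e] exp_quadratic_bound by (intro mult_left_mono) auto
      moreover have "q e * (c e)\<^sup>2 = (if fst e = i \<or> snd e = i then q e else 0) / E"
        using E s2 by (auto simp: c_def power_divide)
      ultimately show "q e * (exp (c e) - 1) - q e * c e \<le> (if fst e = i \<or> snd e = i then q e else 0) / E"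
        by (simp add: distrib_left)
    qed
    also have "\<dots> = (\<Sum>e\<in>slots n. if fst e = i \<or> snd e = i then q e else 0) / E"
      by (simp only: sum_divide_distrib)
    also have "\<dots> \<le> 1" using E by simp
    finally show ?thesis .
  qed
  finally show ?thesis by simp
qed

text \<open>A truncation at \<open>T\<close>: the excess \<open>t\<close> of the modulus over
  \<open>T\<close> satisfies \<open>t^2 \<le> 2 * exp t\<close>. The factor \<open>exp (- T)\<close>
  will offset the large threshold in Markov's inequality, so that only \<open>T^2\<close> is
  lost.\<close>

lemma square_le_exp:
  fixes v :: real
  assumes "0 \<le> T"
  shows "v\<^sup>2 \<le> 2 * T\<^sup>2 + 4 * (exp (- T) * (exp v + exp (- v)))"
proof (cases "\<bar>v\<bar> \<le> T")
  case True
  then have "v\<^sup>2 \<le> T\<^sup>2" using abs_le_square_iff[of v T] assms by simp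
  then show ?thesis using zero_le_power2[of T] by (smt (verit) exp_gt_zero mult_pos_pos)
next
  case False
  define t where "t = \<bar>v\<bar> - T"
  have t: "0 \<le> t" using False by (simp add: t_def)
  have "t\<^sup>2 \<le> 2 * exp t" using exp_lower_Taylor_quadratic[OF t] t by simp
  also have "exp t = exp (- T) * exp \<bar>v\<bar>" by (simp add: t_def mult_exp_exp)
  also have "exp \<bar>v\<bar> \<le> exp v + exp (- v)" by (simp add: abs_if)
  finally have "t\<^sup>2 \<le> 2 * (exp (- T) * (exp v + exp (- v)))" by simp
  moreover have "v\<^sup>2 \<le> 2 * T\<^sup>2 + 2 * t\<^sup>2"
  proof -
    have "v\<^sup>2 = (T + t)\<^sup>2" by (simp add: t_def)
    also have "\<dots> \<le> 2 * T\<^sup>2 + 2 * t\<^sup>2"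
      using zero_le_power2[of "T - t"] unfolding power2_sum power2_diff by linarith
    finally show ?thesis .
  qed
  ultimately show ?thesis by linarith
qed

text \<open>Two degrees share a slot and are dependent, so the sum is controlled through the
  expectation of a sum of exponentials. Truncation at \<open>T = R + 1\<close> leaves
  \<open>2 n (R + 1)^2 + 8 n\<close>, which is at most \<open>10 n (R + 1)^2\<close>.\<close>

lemma degree_event:
  fixes q :: "nat \<times> nat \<Rightarrow> real"
  assumes n: "1 \<le> n" and R: "0 \<le> R"
    and q: "\<And>e. e \<in> slots n \<Longrightarrow> 0 \<le> q e \<and> q e \<le> 1"
    and E: "\<And>i. i < n \<Longrightarrow> 1 \<le> E i"
      "\<And>i. i < n \<Longrightarrow> (\<Sum>e\<in>slots n. if fst e = i \<or> snd e = i then q e else 0) \<le> E i"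
  shows "measure_pmf.prob (bernoulli_product (slots n) q)
    {x. \<not> (\<Sum>i<n. (degree_dev n q x i)\<^sup>2 / E i) \<le> 10 * real n * (R + 1)\<^sup>2} \<le> exp (- R)"
proof -
  let ?P = "bernoulli_product (slots n) q"
  let ?v = "\<lambda>x i. degree_dev n q x i / sqrt (E i)"
  let ?f = "\<lambda>x. \<Sum>i<n. exp (?v x i) + exp (- ?v x i)"
  have int: "integrable (measure_pmf ?P) f" for f :: "_ \<Rightarrow> real"
    by (intro integrable_measure_pmf_finite finite_set_bernoulli_product) simp
  \<comment> \<open>The expectation of \<open>?f\<close> is at most \<open>2 * n * exp 1\<close>, so
    Markov's inequality at this threshold gives exactly \<open>exp (- R)\<close>.\<close>
  have "{x. \<not> (\<Sum>i<n. (degree_dev n q x i)\<^sup>2 / E i) \<le> 10 * real n * (R + 1)\<^sup>2}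
    \<subseteq> {x. 2 * real n * exp (R + 1) \<le> ?f x}"
  proof (rule subsetI, rule ccontr)
    fix x assume x: "x \<in> {x. \<not> (\<Sum>i<n. (degree_dev n q x i)\<^sup>2 / E i) \<le> 10 * real n * (R + 1)\<^sup>2}"
      and "x \<notin> {x. 2 * real n * exp (R + 1) \<le> ?f x}"
    then have f: "?f x \<le> 2 * real n * exp (R + 1)" by simp
    have "(\<Sum>i<n. (degree_dev n q x i)\<^sup>2 / E i) = (\<Sum>i<n. (?v x i)\<^sup>2)"
      using E by (intro sum.cong) (force simp: power_divide)+
    also have "\<dots> \<le> (\<Sum>i<n. 2 * (R + 1)\<^sup>2 + 4 * (exp (- (R + 1)) * (exp (?v x i) + exp (- ?v x i))))"
      using R by (intro sum_mono square_le_exp) auto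
    also have "\<dots> = 2 * real n * (R + 1)\<^sup>2 + 4 * (exp (- (R + 1)) * ?f x)"
      by (simp only: sum.distrib sum_distrib_left[symmetric]) simp
    also have "\<dots> \<le> 2 * real n * (R + 1)\<^sup>2 + 4 * (exp (- (R + 1)) * (2 * real n * exp (R + 1)))"
      using f by (intro add_left_mono mult_left_mono) auto
    also have "exp (- (R + 1)) * (2 * real n * exp (R + 1)) = 2 * real n * (exp (- (R + 1)) * exp (R + 1))"
      by (simp only: mult_ac)
    also have "exp (- (R + 1)) * exp (R + 1) = 1" by (simp only: mult_exp_exp) simp
    also have "2 * real n * (R + 1)\<^sup>2 + 4 * (2 * real n * 1) \<le> 10 * real n * (R + 1)\<^sup>2"
      using R n mult_left_mono[of 1 "(R + 1)\<^sup>2" "real n"] by (simp add: power2_eq_square algebra_simps)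
    finally show False using x by simp
  qed
  then have "measure_pmf.prob ?P {x. \<not> (\<Sum>i<n. (degree_dev n q x i)\<^sup>2 / E i) \<le> 10 * real n * (R + 1)\<^sup>2}
    \<le> measure_pmf.prob ?P {x. 2 * real n * exp (R + 1) \<le> ?f x}"
    by (intro measure_pmf.finite_measure_mono) auto
  also have "\<dots> \<le> measure_pmf.expectation ?P ?f / (2 * real n * exp (R + 1))"
    using n by (intro prob_ge_le_expectation finite_set_bernoulli_product sum_nonneg) (auto intro: add_nonneg_nonneg)
  also have "measure_pmf.expectation ?P ?f
      = (\<Sum>i<n. measure_pmf.expectation ?P (\<lambda>x. exp (?v x i)) + measure_pmf.expectation ?P (\<lambda>x. exp (- ?v x i)))"
    by (simp add: int)
  also have "\<dots> \<le> (\<Sum>i<n. exp 1 + exp 1)"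
  proof (intro sum_mono add_mono)
    fix i assume "i \<in> {..<n}"
    then have "i < n" by simp
    show "measure_pmf.expectation ?P (\<lambda>x. exp (?v x i)) \<le> exp 1"
      using degree_dev_mgf[OF q E(1)[OF \<open>i < n\<close>] E(2)[OF \<open>i < n\<close>], of 1] by simp
    show "measure_pmf.expectation ?P (\<lambda>x. exp (- ?v x i)) \<le> exp 1"
      using degree_dev_mgf[OF q E(1)[OF \<open>i < n\<close>] E(2)[OF \<open>i < n\<close>], of "-1"] by simp
  qed
  also have "(\<Sum>i<n. exp 1 + exp 1) / (2 * real n * exp (R + 1)) = exp (- R)"
    using n by (simp add: exp_add exp_minus field_simps)
  finally show ?thesis by (simp add: divide_right_mono)
qed

section \<open>Normalized forms\<close>

text \<open>Polarization: for \<open>u = N v\<close> the squared norm \<open>U\<close> of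
  \<open>u\<close> is the bilinear form at \<open>u\<close> and \<open>v\<close>, a difference of
  two values of the quadratic form.\<close>

lemma quadratic_form_norm_bound:
  fixes N :: "nat \<Rightarrow> nat \<Rightarrow> real" and v :: "nat \<Rightarrow> real"
  assumes sym: "\<And>i j. i < n \<Longrightarrow> j < n \<Longrightarrow> N i j = N j i" and c: "0 < c"
    and form: "\<And>x. \<bar>\<Sum>i<n. \<Sum>j<n. N i j * (x i * x j)\<bar> \<le> c * (\<Sum>i<n. (x i)\<^sup>2)"
  shows "(\<Sum>i<n. (\<Sum>j<n. N i j * v j)\<^sup>2) \<le> c\<^sup>2 * (\<Sum>i<n. (v i)\<^sup>2)"
proof -
  define u where "u i = (\<Sum>j<n. N i j * v j)" for i
  define Q where "Q x y = (\<Sum>i<n. \<Sum>j<n. N i j * (x i * y j))" for x y :: "nat \<Rightarrow> real"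
  have Qsym: "Q x y = Q y x" for x y
    unfolding Q_def by (subst sum.swap) (auto intro!: sum.cong simp: sym mult.commute)
  define U where "U = (\<Sum>i<n. (u i)\<^sup>2)"
  define V where "V = (\<Sum>i<n. (v i)\<^sup>2)"
  \<comment> \<open>This scaling balances the two vectors:
    \<open>4 s U \<le> c (2 s^2 U + 2 V)\<close> becomes \<open>U / c \<le> c V\<close>.\<close>
  define s where "s = 1 / c"
  have Quv: "Q u v = U"
    by (auto simp: Q_def U_def u_def power2_eq_square sum_distrib_left mult_ac intro!: sum.cong)
  have bilinear: "Q (\<lambda>i. s * u i + t * v i) (\<lambda>i. s * u i + t * v i)
      = s\<^sup>2 * Q u u + s * t * Q u v + s * t * Q v u + t\<^sup>2 * Q v v" for t
  proof -
    have "Q (\<lambda>i. s * u i + t * v i) (\<lambda>i. s * u i + t * v i)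
      = (\<Sum>i<n. \<Sum>j<n. s\<^sup>2 * (N i j * (u i * u j)) + s * t * (N i j * (u i * v j))
          + s * t * (N i j * (v i * u j)) + t\<^sup>2 * (N i j * (v i * v j)))"
      unfolding Q_def by (intro sum.cong refl) (simp add: power2_eq_square algebra_simps)
    then show ?thesis by (simp only: Q_def sum.distrib sum_distrib_left)
  qed
  have plus: "Q (\<lambda>i. s * u i + v i) (\<lambda>i. s * u i + v i) = s\<^sup>2 * Q u u + s * Q u v + s * Q v u + Q v v"
    using bilinear[of 1] by simp
  have minus: "Q (\<lambda>i. s * u i - v i) (\<lambda>i. s * u i - v i) = s\<^sup>2 * Q u u - s * Q u v - s * Q v u + Q v v"
    using bilinear[of "-1"] by simp
  have "4 * (s * U) = Q (\<lambda>i. s * u i + v i) (\<lambda>i. s * u i + v i) - Q (\<lambda>i. s * u i - v i) (\<lambda>i. s * u i - v i)"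
    unfolding plus minus using Qsym[of v u] Quv by simp
  also have "\<dots> \<le> c * (\<Sum>i<n. (s * u i + v i)\<^sup>2) + c * (\<Sum>i<n. (s * u i - v i)\<^sup>2)"
    using form[of "\<lambda>i. s * u i + v i"] form[of "\<lambda>i. s * u i - v i"] unfolding Q_def by linarith
  also have "\<dots> = c * (2 * s\<^sup>2 * U + 2 * V)"
  proof -
    have "(\<Sum>i<n. (s * u i + v i)\<^sup>2) + (\<Sum>i<n. (s * u i - v i)\<^sup>2)
      = (\<Sum>i<n. 2 * s\<^sup>2 * (u i)\<^sup>2 + 2 * (v i)\<^sup>2)"
      unfolding sum.distrib[symmetric]
      by (intro sum.cong refl) (simp add: power2_eq_square algebra_simps)
    then show ?thesis
      unfolding distrib_left[symmetric] U_def V_def by (simp only: sum.distrib sum_distrib_left)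
  qed
  finally have "4 * (s * U) \<le> c * (2 * s\<^sup>2 * U + 2 * V)" .
  then have "U / c \<le> c * V"
    using c by (simp add: s_def power2_eq_square distrib_left)
  then have "U \<le> c\<^sup>2 * V" using c by (simp add: pos_divide_le_eq power2_eq_square mult_ac)
  then show ?thesis by (simp add: U_def V_def u_def)
qed

text \<open>Schur's test: the product of two coordinates is at most the mean of their squares, and
  each row sum cancels its own normalization.\<close>

lemma normalized_form_le:
  fixes M :: "nat \<Rightarrow> nat \<Rightarrow> real"
  assumes sym: "\<And>i j. i < n \<Longrightarrow> j < n \<Longrightarrow> M i j = M j i"
    and M: "\<And>i j. i < n \<Longrightarrow> j < n \<Longrightarrow> 0 \<le> M i j"
    and F: "\<And>i. i < n \<Longrightarrow> F i = (\<Sum>j<n. M i j)" "\<And>i. i < n \<Longrightarrow> 0 < F i"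
  shows "\<bar>\<Sum>i<n. \<Sum>j<n. M i j / (sqrt (F i) * sqrt (F j)) * (x i * x j)\<bar> \<le> (\<Sum>i<n. (x i)\<^sup>2)"
proof -
  define u where "u i = x i / sqrt (F i)" for i
  have "\<bar>\<Sum>i<n. \<Sum>j<n. M i j / (sqrt (F i) * sqrt (F j)) * (x i * x j)\<bar>
    \<le> (\<Sum>i<n. \<Sum>j<n. \<bar>M i j / (sqrt (F i) * sqrt (F j)) * (x i * x j)\<bar>)"
    by (intro order.trans[OF sum_abs] sum_mono order.refl)
  also have "\<dots> \<le> (\<Sum>i<n. \<Sum>j<n. M i j * (u i)\<^sup>2 / 2 + M i j * (u j)\<^sup>2 / 2)"
  proof (intro sum_mono)
    fix i j assume ij: "i \<in> {..<n}" "j \<in> {..<n}"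
    have "\<bar>M i j / (sqrt (F i) * sqrt (F j)) * (x i * x j)\<bar> = M i j * \<bar>u i * u j\<bar>"
      using M ij by (simp add: u_def abs_mult)
    also have "\<bar>u i * u j\<bar> \<le> (u i)\<^sup>2 / 2 + (u j)\<^sup>2 / 2"
      using zero_le_power2[of "\<bar>u i\<bar> - \<bar>u j\<bar>"] by (simp add: power2_diff abs_mult)
    finally show "\<bar>M i j / (sqrt (F i) * sqrt (F j)) * (x i * x j)\<bar> \<le> M i j * (u i)\<^sup>2 / 2 + M i j * (u j)\<^sup>2 / 2"
      using M ij by (simp add: mult_left_mono distrib_left)
  qed
  also have "\<dots> = (\<Sum>i<n. \<Sum>j<n. M i j * (u i)\<^sup>2 / 2) + (\<Sum>i<n. \<Sum>j<n. M i j * (u j)\<^sup>2 / 2)"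
    by (simp only: sum.distrib)
  also have "(\<Sum>i<n. \<Sum>j<n. M i j * (u j)\<^sup>2 / 2) = (\<Sum>i<n. \<Sum>j<n. M i j * (u i)\<^sup>2 / 2)"
    by (subst sum.swap) (auto intro!: sum.cong simp: sym)
  also have "(\<Sum>i<n. \<Sum>j<n. M i j * (u i)\<^sup>2 / 2) = (\<Sum>i<n. (x i)\<^sup>2 / 2)"
  proof (rule sum.cong[OF refl])
    fix i assume "i \<in> {..<n}"
    then have "(\<Sum>j<n. M i j * (u i)\<^sup>2 / 2) = F i * ((u i)\<^sup>2 / 2)"
      by (simp add: F sum_distrib_right)
    also have "\<dots> = (x i)\<^sup>2 / 2" using F(2)[of i] \<open>i \<in> {..<n}\<close> by (simp add: u_def power_divide)
    finally show "(\<Sum>j<n. M i j * (u i)\<^sup>2 / 2) = (x i)\<^sup>2 / 2" .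
  qed
  also have "(\<Sum>i<n. (x i)\<^sup>2 / 2) + (\<Sum>i<n. (x i)\<^sup>2 / 2) = (\<Sum>i<n. (x i)\<^sup>2)"
    by (simp add: sum.distrib[symmetric])
  finally show ?thesis .
qed

lemma hilbert_schmidt_form_le:
  fixes N :: "nat \<Rightarrow> nat \<Rightarrow> real"
  shows "\<bar>\<Sum>i<n. \<Sum>j<n. N i j * (x i * x j)\<bar> \<le> sqrt (\<Sum>i<n. \<Sum>j<n. (N i j)\<^sup>2) * (\<Sum>i<n. (x i)\<^sup>2)"
proof -
  have "\<bar>\<Sum>i<n. \<Sum>j<n. N i j * (x i * x j)\<bar> = \<bar>\<Sum>(i, j)\<in>{..<n} \<times> {..<n}. N i j * (x i * x j)\<bar>"
    by (simp add: sum.cartesian_product)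
  also have "\<dots> \<le> sqrt ((\<Sum>(i, j)\<in>{..<n} \<times> {..<n}. (N i j)\<^sup>2) * (\<Sum>(i, j)\<in>{..<n} \<times> {..<n}. (x i * x j)\<^sup>2))"
    using Cauchy_Schwarz_ineq_sum[of "\<lambda>(i, j). N i j" "\<lambda>(i, j). x i * x j" "{..<n} \<times> {..<n}"]
    by (intro real_le_rsqrt) (simp add: case_prod_beta)
  also have "(\<Sum>(i, j)\<in>{..<n} \<times> {..<n}. (x i * x j)\<^sup>2) = (\<Sum>i<n. (x i)\<^sup>2)\<^sup>2"
    by (simp add: sum.cartesian_product[symmetric] power_mult_distrib sum_product power2_eq_square[of "sum _ _"])
  also have "(\<Sum>(i, j)\<in>{..<n} \<times> {..<n}. (N i j)\<^sup>2) = (\<Sum>i<n. \<Sum>j<n. (N i j)\<^sup>2)"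
    by (simp add: sum.cartesian_product)
  finally show ?thesis by (simp add: real_sqrt_mult sum_nonneg)
qed

text \<open>Write \<open>sqrt D - sqrt E\<close> as \<open>(D - E) / (sqrt D + sqrt E)\<close>,
  bound the denominator below by \<open>sqrt E\<close>, and use \<open>D \<ge> \<tau>\<close>
  once.\<close>

lemma inverse_sqrt_diff_bound:
  fixes D E \<tau> :: real
  assumes "0 < \<tau>" "\<tau> \<le> D" "0 < E"
  shows "(1 / sqrt E - 1 / sqrt D)\<^sup>2 * E \<le> (D - E)\<^sup>2 / E / \<tau>"
proof -
  define d e where "d = sqrt D" and "e = sqrt E"
  have de: "0 < d" "0 < e" "D = d\<^sup>2" "E = e\<^sup>2" using assms by (auto simp: d_def e_def)
  have "(1 / e - 1 / d)\<^sup>2 * e\<^sup>2 = (d - e)\<^sup>2 / d\<^sup>2"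
  proof -
    have "(1 / e - 1 / d) * e = (d - e) / d" using de by (simp add: field_simps)
    then show ?thesis unfolding power_mult_distrib[symmetric] by (simp add: power_divide)
  qed
  also have "\<dots> \<le> ((d - e)\<^sup>2 * (d + e)\<^sup>2 / e\<^sup>2) / d\<^sup>2"
  proof (rule divide_right_mono)
    have "(d - e)\<^sup>2 * e\<^sup>2 \<le> (d - e)\<^sup>2 * (d + e)\<^sup>2"
      using de by (intro mult_left_mono power_mono) auto
    then show "(d - e)\<^sup>2 \<le> (d - e)\<^sup>2 * (d + e)\<^sup>2 / e\<^sup>2" using de by (simp add: pos_le_divide_eq)
  qed simp
  also have "(d - e)\<^sup>2 * (d + e)\<^sup>2 = (D - E)\<^sup>2"
    unfolding de power_mult_distrib[symmetric] by (simp add: algebra_simps power2_eq_square)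
  also have "(D - E)\<^sup>2 / e\<^sup>2 / d\<^sup>2 \<le> (D - E)\<^sup>2 / e\<^sup>2 / \<tau>"
    using assms de by (intro divide_left_mono) auto
  finally show ?thesis by (simp only: de(4)[symmetric] d_def[symmetric] e_def[symmetric])
qed

text \<open>The two degree factors are replaced one after the other. By symmetry both replacements
  cost the same, and \<open>(s + t)^2 \<le> 2 s^2 + 2 t^2\<close> then gives the factor 4.\<close>

lemma degree_change_hs_bound:
  fixes P :: "nat \<Rightarrow> nat \<Rightarrow> real"
  assumes sym: "\<And>i j. i < n \<Longrightarrow> j < n \<Longrightarrow> P i j = P j i"
    and P: "\<And>i j. i < n \<Longrightarrow> j < n \<Longrightarrow> 0 \<le> P i j \<and> P i j \<le> k"
    and E: "\<And>i. i < n \<Longrightarrow> E i = (\<Sum>j<n. P i j)"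
    and \<tau>: "0 < \<tau>" "\<And>i. i < n \<Longrightarrow> \<tau> \<le> E i" "\<And>i. i < n \<Longrightarrow> \<tau> \<le> D i"
  shows "(\<Sum>i<n. \<Sum>j<n. (P i j / (sqrt (E i) * sqrt (E j)) - P i j / (sqrt (D i) * sqrt (D j)))\<^sup>2)
    \<le> 4 * k / \<tau>\<^sup>2 * (\<Sum>i<n. (D i - E i)\<^sup>2 / E i)"
proof -
  define g where "g i = 1 / sqrt (E i) - 1 / sqrt (D i)" for i
  have pos: "0 < E i" "0 < D i" if "i < n" for i using \<tau>(1) \<tau>(2)[OF that] \<tau>(3)[OF that] by linarith+
  \<comment> \<open>Bounding one factor of each square by \<open>k\<close> leaves a row sum. With
    \<open>k = K / n\<close> this is the source of the averaging over the vertices.\<close>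
  have rowsq: "(\<Sum>j<n. (P i j)\<^sup>2) \<le> k * E i" if "i < n" for i
  proof -
    have "(\<Sum>j<n. (P i j)\<^sup>2) \<le> (\<Sum>j<n. k * P i j)"
      using P that by (intro sum_mono) (auto simp: power2_eq_square intro!: mult_right_mono)
    then show ?thesis by (simp add: E[OF that] sum_distrib_left)
  qed
  have half: "(\<Sum>i<n. \<Sum>j<n. (P i j)\<^sup>2 * ((g i)\<^sup>2 / \<tau>)) \<le> k / \<tau>\<^sup>2 * (\<Sum>i<n. (D i - E i)\<^sup>2 / E i)"
  proof -
    have "(\<Sum>i<n. \<Sum>j<n. (P i j)\<^sup>2 * ((g i)\<^sup>2 / \<tau>)) \<le> (\<Sum>i<n. k / \<tau>\<^sup>2 * ((D i - E i)\<^sup>2 / E i))"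
    proof (rule sum_mono)
      fix i assume "i \<in> {..<n}"
      then have i: "i < n" by simp
      have k: "0 \<le> k" using P[OF i i] by linarith
      have "(\<Sum>j<n. (P i j)\<^sup>2 * ((g i)\<^sup>2 / \<tau>)) = (\<Sum>j<n. (P i j)\<^sup>2) * ((g i)\<^sup>2 / \<tau>)"
        by (simp only: sum_distrib_right)
      also have "\<dots> \<le> k * E i * ((g i)\<^sup>2 / \<tau>)"
        using rowsq[OF i] \<tau>(1) by (intro mult_right_mono) auto
      also have "\<dots> = k / \<tau> * ((g i)\<^sup>2 * E i)" by simp
      also have "\<dots> \<le> k / \<tau> * ((D i - E i)\<^sup>2 / E i / \<tau>)"
        unfolding g_def using \<tau>(1) \<tau>(3)[OF i] pos[OF i] k
        by (intro mult_left_mono inverse_sqrt_diff_bound) auto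
      also have "\<dots> = k / \<tau>\<^sup>2 * ((D i - E i)\<^sup>2 / E i)" by (simp add: power2_eq_square)
      finally show "(\<Sum>j<n. (P i j)\<^sup>2 * ((g i)\<^sup>2 / \<tau>)) \<le> k / \<tau>\<^sup>2 * ((D i - E i)\<^sup>2 / E i)" .
    qed
    then show ?thesis by (simp only: sum_distrib_left)
  qed
  have "(\<Sum>i<n. \<Sum>j<n. (P i j / (sqrt (E i) * sqrt (E j)) - P i j / (sqrt (D i) * sqrt (D j)))\<^sup>2)
    \<le> (\<Sum>i<n. \<Sum>j<n. 2 * ((P i j)\<^sup>2 * ((g i)\<^sup>2 / \<tau>)) + 2 * ((P j i)\<^sup>2 * ((g j)\<^sup>2 / \<tau>)))"
  proof (intro sum_mono)
    fix i j assume "i \<in> {..<n}" "j \<in> {..<n}"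
    then have ij: "i < n" "j < n" by auto
    have "P i j / (sqrt (E i) * sqrt (E j)) - P i j / (sqrt (D i) * sqrt (D j))
      = P i j * (g i * (1 / sqrt (E j)) + g j * (1 / sqrt (D i)))"
      by (simp add: g_def algebra_simps)
    then have "(P i j / (sqrt (E i) * sqrt (E j)) - P i j / (sqrt (D i) * sqrt (D j)))\<^sup>2
      = (P i j)\<^sup>2 * (g i * (1 / sqrt (E j)) + g j * (1 / sqrt (D i)))\<^sup>2"
      by (simp only: power_mult_distrib)
    also have "\<dots> \<le> (P i j)\<^sup>2 * (2 * ((g i)\<^sup>2 / \<tau>) + 2 * ((g j)\<^sup>2 / \<tau>))"
    proof (rule mult_left_mono)
      have *: "(g i * (1 / sqrt (E j)))\<^sup>2 \<le> (g i)\<^sup>2 / \<tau>" for i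
        using \<tau> pos[OF ij(2)] ij by (simp add: power_mult_distrib power_divide) (intro divide_left_mono, auto)
      have **: "(g j * (1 / sqrt (D i)))\<^sup>2 \<le> (g j)\<^sup>2 / \<tau>"
        using \<tau> pos[OF ij(1)] ij by (simp add: power_mult_distrib power_divide) (intro divide_left_mono, auto)
      have "(g i * (1 / sqrt (E j)) + g j * (1 / sqrt (D i)))\<^sup>2
        \<le> 2 * (g i * (1 / sqrt (E j)))\<^sup>2 + 2 * (g j * (1 / sqrt (D i)))\<^sup>2"
        using zero_le_power2[of "g i * (1 / sqrt (E j)) - g j * (1 / sqrt (D i))"]
        unfolding power2_sum power2_diff by linarith
      then show "(g i * (1 / sqrt (E j)) + g j * (1 / sqrt (D i)))\<^sup>2 \<le> 2 * ((g i)\<^sup>2 / \<tau>) + 2 * ((g j)\<^sup>2 / \<tau>)"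
        using *[of i] ** by linarith
    qed simp
    also have "\<dots> = 2 * ((P i j)\<^sup>2 * ((g i)\<^sup>2 / \<tau>)) + 2 * ((P j i)\<^sup>2 * ((g j)\<^sup>2 / \<tau>))"
      by (simp only: sym[OF ij] distrib_left mult.left_commute)
    finally show "(P i j / (sqrt (E i) * sqrt (E j)) - P i j / (sqrt (D i) * sqrt (D j)))\<^sup>2
      \<le> 2 * ((P i j)\<^sup>2 * ((g i)\<^sup>2 / \<tau>)) + 2 * ((P j i)\<^sup>2 * ((g j)\<^sup>2 / \<tau>))" .
  qed
  also have "\<dots> = 2 * (\<Sum>i<n. \<Sum>j<n. (P i j)\<^sup>2 * ((g i)\<^sup>2 / \<tau>)) + 2 * (\<Sum>i<n. \<Sum>j<n. (P j i)\<^sup>2 * ((g j)\<^sup>2 / \<tau>))"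
    by (simp only: sum.distrib sum_distrib_left)
  also have "(\<Sum>i<n. \<Sum>j<n. (P j i)\<^sup>2 * ((g j)\<^sup>2 / \<tau>)) = (\<Sum>i<n. \<Sum>j<n. (P i j)\<^sup>2 * ((g i)\<^sup>2 / \<tau>))"
    by (rule sum.swap)
  finally show ?thesis using half by simp
qed

lemma sum_neighbours_slots:
  fixes f :: "nat \<Rightarrow> nat \<Rightarrow> real"
  assumes sym: "\<And>i j. i < n \<Longrightarrow> j < n \<Longrightarrow> f i j = f j i" and diag: "f k k = 0" and k: "k < n"
  shows "(\<Sum>j<n. f k j) = (\<Sum>e\<in>slots n. if fst e = k \<or> snd e = k then f (fst e) (snd e) else 0)"
proof -
  have "(\<Sum>j<n. f k j) = (\<Sum>i<n. if i = k then (\<Sum>j<n. f k j) else 0)" using k by simp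
  also have "\<dots> = (\<Sum>i<n. \<Sum>j<n. if i = k then f i j else 0)"
    by (intro sum.cong refl) (auto intro!: sum.neutral)
  also have "\<dots> = (\<Sum>(i, j)\<in>slots n. (if i = k then f i j else 0) + (if j = k then f j i else 0))
      + (\<Sum>i<n. if i = k then f i i else 0)"
    by (rule sum_square_slots)
  also have "(\<Sum>i<n. if i = k then f i i else 0) = 0" using diag by (intro sum.neutral) auto
  also have "(\<Sum>(i, j)\<in>slots n. (if i = k then f i j else 0) + (if j = k then f j i else 0))
      = (\<Sum>e\<in>slots n. if fst e = k \<or> snd e = k then f (fst e) (snd e) else 0)"
    by (rule sum.cong) (auto simp: slots_def sym)
  finally show ?thesis by simp
qed

section \<open>The Laplacian\<close>

text \<open>Deterministic on the good event: the change of degrees in the expected part contributes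
  35 and the centred adjacency matrix 510, in units of \<open>r * sqrt K / \<tau>\<close>.\<close>

lemma normalized_difference_form_bound:
  fixes a p :: "nat \<Rightarrow> nat \<Rightarrow> real"
  assumes n: "1 \<le> n" and r: "1 \<le> r" and \<tau>: "1 \<le> \<tau>" "\<tau> \<le> K"
    and a: "\<And>i j. a i j = a j i" "\<And>i j. 0 \<le> a i j" "\<And>i. a i i = 0"
    and p: "\<And>i j. i < n \<Longrightarrow> j < n \<Longrightarrow> p i j = p j i" "\<And>i j. i < n \<Longrightarrow> j < n \<Longrightarrow> 0 \<le> p i j"
      "\<And>i. i < n \<Longrightarrow> p i i = 0"
    and pK: "\<And>i j. i < n \<Longrightarrow> j < n \<Longrightarrow> p i j + \<tau> / real n \<le> K / real n"
    and D: "\<And>i. i < n \<Longrightarrow> D i = (\<Sum>j<n. a i j) + \<tau>" and E: "\<And>i. i < n \<Longrightarrow> E i = (\<Sum>j<n. p i j) + \<tau>"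
    and form: "\<And>z. \<bar>slot_form n (\<lambda>e. a (fst e) (snd e) - p (fst e) (snd e)) z\<bar>
      \<le> sqrt K * (211 + 10 * (r + 3)) * (\<Sum>i<n. (z i)\<^sup>2) + 4 / sqrt K * edge_energy n (\<lambda>e. a (fst e) (snd e)) z"
    and deg: "(\<Sum>i<n. (D i - E i)\<^sup>2 / E i) \<le> 10 * real n * (r + 3 + 1)\<^sup>2"
  shows "\<bar>\<Sum>i<n. \<Sum>j<n. ((p i j + \<tau> / real n) / (sqrt (E i) * sqrt (E j))
        - (a i j + \<tau> / real n) / (sqrt (D i) * sqrt (D j))) * (x i * x j)\<bar>
    \<le> 545 * r * sqrt K / \<tau> * (\<Sum>i<n. (x i)\<^sup>2)"
proof -
  have sK: "1 \<le> sqrt K" "sqrt K * sqrt K = K" using \<tau> by auto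
  define X where "X = (\<Sum>i<n. (x i)\<^sup>2)"
  have X: "0 \<le> X" by (simp add: X_def sum_nonneg)
  have D\<tau>: "\<tau> \<le> D i" if "i < n" for i using a D[OF that] by (simp add: sum_nonneg)
  have E\<tau>: "\<tau> \<le> E i" if "i < n" for i using p(2) that E[OF that] by (auto intro: sum_nonneg)
  define u where "u i = x i / sqrt (D i)" for i
  define N1 where "N1 i j = (p i j + \<tau> / real n) / (sqrt (E i) * sqrt (E j))
      - (p i j + \<tau> / real n) / (sqrt (D i) * sqrt (D j))" for i j
  \<comment> \<open>Add and subtract the expected matrix normalized by the random degrees. In the
    second part the regularization \<open>\<tau> / n\<close> cancels.\<close>
  have "(\<Sum>i<n. \<Sum>j<n. ((p i j + \<tau> / real n) / (sqrt (E i) * sqrt (E j))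
        - (a i j + \<tau> / real n) / (sqrt (D i) * sqrt (D j))) * (x i * x j))
    = (\<Sum>i<n. \<Sum>j<n. N1 i j * (x i * x j) + (p i j - a i j) * (u i * u j))"
    by (intro sum.cong refl) (simp add: N1_def u_def add_divide_distrib diff_divide_distrib algebra_simps)
  also have "\<dots> = (\<Sum>i<n. \<Sum>j<n. N1 i j * (x i * x j)) + (\<Sum>i<n. \<Sum>j<n. (p i j - a i j) * (u i * u j))"
    by (simp only: sum.distrib)
  finally have split: "(\<Sum>i<n. \<Sum>j<n. ((p i j + \<tau> / real n) / (sqrt (E i) * sqrt (E j))
        - (a i j + \<tau> / real n) / (sqrt (D i) * sqrt (D j))) * (x i * x j))
    = (\<Sum>i<n. \<Sum>j<n. N1 i j * (x i * x j)) + (\<Sum>i<n. \<Sum>j<n. (p i j - a i j) * (u i * u j))" .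
  have mean: "\<bar>\<Sum>i<n. \<Sum>j<n. N1 i j * (x i * x j)\<bar> \<le> 35 * r * sqrt K / \<tau> * X"
  proof -
    have "(\<Sum>i<n. \<Sum>j<n. (N1 i j)\<^sup>2) \<le> 4 * (K / real n) / \<tau>\<^sup>2 * (\<Sum>i<n. (D i - E i)\<^sup>2 / E i)"
      unfolding N1_def
    proof (rule degree_change_hs_bound)
      fix i assume "i < n"
      then show "E i = (\<Sum>j<n. p i j + \<tau> / real n)" using n by (simp add: E sum.distrib)
    qed (use p pK \<tau> D\<tau> E\<tau> in auto)
    also have "\<dots> \<le> 4 * (K / real n) / \<tau>\<^sup>2 * (10 * real n * (r + 3 + 1)\<^sup>2)"
      using \<tau> by (intro mult_left_mono deg) auto
    also have "\<dots> = 40 * (r + 4)\<^sup>2 * (K / \<tau>\<^sup>2)" using n by (simp add: field_simps)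
    \<comment> \<open>As \<open>r \<ge> 1\<close>, \<open>r + 4 \<le> 5 r\<close>; then
      \<open>40 * 25 = 1000\<close> is rounded up to the square \<open>35^2 = 1225\<close>.\<close>
    also have "\<dots> \<le> (7 * (5 * r))\<^sup>2 * (K / \<tau>\<^sup>2)"
    proof (rule mult_right_mono)
      have "(r + 4)\<^sup>2 \<le> (5 * r)\<^sup>2" using r by (intro power_mono) auto
      then have "(r + 4)\<^sup>2 \<le> 25 * r\<^sup>2" by (simp add: power_mult_distrib)
      then have "40 * (r + 4)\<^sup>2 \<le> 1225 * r\<^sup>2" using zero_le_power2[of r] by linarith
      then show "40 * (r + 4)\<^sup>2 \<le> (7 * (5 * r))\<^sup>2" by (simp add: power_mult_distrib)
    qed (use \<tau> in auto)
    also have "\<dots> = (35 * r * sqrt K / \<tau>)\<^sup>2"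
      using \<tau> by (simp add: power_mult_distrib power_divide)
    finally have "sqrt (\<Sum>i<n. \<Sum>j<n. (N1 i j)\<^sup>2) \<le> 35 * r * sqrt K / \<tau>"
      using r \<tau> by (intro real_le_lsqrt) auto
    then have "sqrt (\<Sum>i<n. \<Sum>j<n. (N1 i j)\<^sup>2) * X \<le> 35 * r * sqrt K / \<tau> * X"
      using X by (rule mult_right_mono)
    with hilbert_schmidt_form_le[where n = n and N = N1 and x = x] show ?thesis
      unfolding X_def by (rule order.trans)
  qed
  have noise: "\<bar>\<Sum>i<n. \<Sum>j<n. (p i j - a i j) * (u i * u j)\<bar> \<le> 510 * r * sqrt K / \<tau> * X"
  proof -
    have "(\<Sum>i<n. \<Sum>j<n. (p i j - a i j) * (u i * u j))
      = (\<Sum>(i, j)\<in>slots n. (p i j - a i j) * (u i * u j) + (p j i - a j i) * (u j * u i))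
        + (\<Sum>i<n. (p i i - a i i) * (u i * u i))"
      by (rule sum_square_slots)
    also have "(\<Sum>i<n. (p i i - a i i) * (u i * u i)) = 0" using a p by (intro sum.neutral) auto
    also have "(\<Sum>(i, j)\<in>slots n. (p i j - a i j) * (u i * u j) + (p j i - a j i) * (u j * u i))
      = - 2 * slot_form n (\<lambda>e. a (fst e) (snd e) - p (fst e) (snd e)) u"
      unfolding slot_form_def sum_distrib_left
    proof (rule sum.cong[OF refl], clarify)
      fix i j assume "(i, j) \<in> slots n"
      then have "p j i = p i j" using p(1) by (auto simp: slots_def)
      then show "(p i j - a i j) * (u i * u j) + (p j i - a j i) * (u j * u i)
        = - 2 * ((a (fst (i, j)) (snd (i, j)) - p (fst (i, j)) (snd (i, j))) * (u i * u j))"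
        using a(1)[of j i] by (simp add: algebra_simps)
    qed
    finally have eq: "\<bar>\<Sum>i<n. \<Sum>j<n. (p i j - a i j) * (u i * u j)\<bar>
      = 2 * \<bar>slot_form n (\<lambda>e. a (fst e) (snd e) - p (fst e) (snd e)) u\<bar>" by simp
    have usq: "(\<Sum>i<n. (u i)\<^sup>2) \<le> X / \<tau>"
    proof -
      have "(\<Sum>i<n. (u i)\<^sup>2) \<le> (\<Sum>i<n. (x i)\<^sup>2 / \<tau>)"
      proof (rule sum_mono)
        fix i assume "i \<in> {..<n}"
        then have "\<tau> \<le> D i" using D\<tau> by simp
        then show "(u i)\<^sup>2 \<le> (x i)\<^sup>2 / \<tau>"
          using \<tau> by (simp add: u_def power_divide) (intro divide_left_mono, auto)
      qed
      then show ?thesis by (simp only: X_def sum_divide_distrib)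
    qed
    \<comment> \<open>The degree term is harmless here: at \<open>u i = x i / sqrt (D i)\<close>
      each degree is divided by \<open>D i\<close>, which is at least as large.\<close>
    have energy: "edge_energy n (\<lambda>e. a (fst e) (snd e)) u \<le> X"
    proof -
      have "edge_energy n (\<lambda>e. a (fst e) (snd e)) u = (\<Sum>(i, j)\<in>slots n. a i j * (u i)\<^sup>2 + a j i * (u j)\<^sup>2)"
        unfolding edge_energy_def using a(1) by (intro sum.cong) (auto simp: distrib_left)
      also have "\<dots> = (\<Sum>i<n. \<Sum>j<n. a i j * (u i)\<^sup>2)"
        by (subst sum_square_slots) (simp add: a(3))
      also have "\<dots> \<le> (\<Sum>i<n. (x i)\<^sup>2)"
      proof (rule sum_mono)
        fix i assume "i \<in> {..<n}"
        then have i: "i < n" by simp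
        have "(\<Sum>j<n. a i j * (u i)\<^sup>2) = (\<Sum>j<n. a i j) * (u i)\<^sup>2" by (simp only: sum_distrib_right)
        also have "\<dots> \<le> D i * (u i)\<^sup>2" using D[OF i] \<tau> by (intro mult_right_mono) auto
        also have "\<dots> = (x i)\<^sup>2" using D\<tau>[OF i] \<tau> by (simp add: u_def power_divide)
        finally show "(\<Sum>j<n. a i j * (u i)\<^sup>2) \<le> (x i)\<^sup>2" .
      qed
      finally show ?thesis by (simp add: X_def)
    qed
    have "\<bar>slot_form n (\<lambda>e. a (fst e) (snd e) - p (fst e) (snd e)) u\<bar>
      \<le> sqrt K * (211 + 10 * (r + 3)) * (X / \<tau>) + 4 / sqrt K * X"
      using sK r by (intro order.trans[OF form] add_mono mult_left_mono usq energy) auto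
    \<comment> \<open>\<open>211 + 10 (r + 3) = 241 + 10 r\<close> is at most \<open>251 r\<close>,
      and \<open>\<tau> \<le> K\<close> brings the energy term to the same order.\<close>
    also have "\<dots> \<le> sqrt K * (251 * r) * (X / \<tau>) + 4 * sqrt K * r * (X / \<tau>)"
    proof (rule add_mono)
      show "sqrt K * (211 + 10 * (r + 3)) * (X / \<tau>) \<le> sqrt K * (251 * r) * (X / \<tau>)"
        using sK r X \<tau> by (intro mult_right_mono mult_left_mono) auto
      have "K * 1 \<le> K * r" using \<tau> r by (intro mult_left_mono) auto
      then have "\<tau> \<le> (sqrt K * sqrt K) * r" using \<tau> unfolding sK(2) by linarith
      then have "4 / sqrt K \<le> 4 * sqrt K * r / \<tau>" using sK \<tau> by (simp add: divide_simps) (simp add: mult_ac)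
      then have "4 / sqrt K * X \<le> (4 * sqrt K * r / \<tau>) * X" using X by (rule mult_right_mono)
      then show "4 / sqrt K * X \<le> 4 * sqrt K * r * (X / \<tau>)" by simp
    qed
    also have "\<dots> = 255 * r * sqrt K / \<tau> * X" by (simp add: field_simps)
    finally show ?thesis unfolding eq by simp
  qed
  show ?thesis
    unfolding split using mean noise by (simp add: X_def[symmetric] algebra_simps add_divide_distrib)
qed

section \<open>From matrices to quadratic forms\<close>

lemma vec_norm2_eq: "v \<in> carrier_vec n \<Longrightarrow> vec_norm2 v = sqrt (\<Sum>i<n. (v $ i)\<^sup>2)"
  by (auto simp: vec_norm2_def scalar_prod_def power2_eq_square lessThan_atLeast0)

lemma spectral_norm_le:
  assumes M: "M \<in> carrier_mat n n" and c: "0 \<le> c"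
    and bound: "\<And>v. (\<Sum>i<n. (\<Sum>j<n. M $$ (i, j) * v j)\<^sup>2) \<le> c\<^sup>2 * (\<Sum>i<n. (v i)\<^sup>2)"
  shows "spectral_norm M \<le> c"
  unfolding spectral_norm_def
proof (rule cSUP_least)
  have "0\<^sub>v (dim_col M) \<in> {v \<in> carrier_vec (dim_col M). vec_norm2 v \<le> 1}"
    by (auto simp: vec_norm2_def)
  then show "{v \<in> carrier_vec (dim_col M). vec_norm2 v \<le> 1} \<noteq> {}" by blast
next
  fix v assume "v \<in> {v \<in> carrier_vec (dim_col M). vec_norm2 v \<le> 1}"
  then have v: "v \<in> carrier_vec n" "vec_norm2 v \<le> 1" using M by auto
  have "(M *\<^sub>v v) $ i = (\<Sum>j<n. M $$ (i, j) * v $ j)" if "i < n" for i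
    using M v that by (auto simp: scalar_prod_def lessThan_atLeast0)
  then have "vec_norm2 (M *\<^sub>v v) = sqrt (\<Sum>i<n. (\<Sum>j<n. M $$ (i, j) * v $ j)\<^sup>2)"
    using mult_mat_vec_carrier[OF M v(1)] by (simp add: vec_norm2_eq)
  also have "\<dots> \<le> sqrt (c\<^sup>2 * (\<Sum>i<n. (v $ i)\<^sup>2))" by (intro real_sqrt_le_mono bound)
  also have "\<dots> = c * vec_norm2 v" using c v by (simp add: real_sqrt_mult vec_norm2_eq)
  also have "\<dots> \<le> c" using v c mult_left_mono[of "vec_norm2 v" 1 c] by simp
  finally show "vec_norm2 (M *\<^sub>v v) \<le> c" .
qed

lemma laplacian_carrier: "M \<in> carrier_mat n n \<Longrightarrow> laplacian M \<in> carrier_mat n n"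
  by (auto simp: laplacian_def Let_def intro!: minus_carrier_mat mult_carrier_mat[of _ n n])

lemma laplacian_entry:
  assumes M: "M \<in> carrier_mat n n" and F: "\<And>i. i < n \<Longrightarrow> row_sum M i = F i" "\<And>i. i < n \<Longrightarrow> 0 < F i"
    and ij: "i < n" "j < n"
  shows "laplacian M $$ (i, j) = of_bool (i = j) - M $$ (i, j) / (sqrt (F i) * sqrt (F j))"
proof -
  have pw: "row_sum M i powr (- 1 / 2) = 1 / sqrt (F i)" if "i < n" for i
    using F(1)[OF that] F(2)[OF that] powr_minus_divide[of "F i" "1/2"] powr_half_sqrt[of "F i"] by simp
  let ?f = "\<lambda>i. row_sum M i powr (- 1 / 2)"
  have "mat_diag n ?f * M = Matrix.mat n n (\<lambda>(i, j). ?f i * M $$ (i, j))"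
    using M by (rule mat_diag_mult_left)
  then have "mat_diag n ?f * M * mat_diag n ?f = Matrix.mat n n (\<lambda>(i, j). ?f i * M $$ (i, j) * ?f j)"
    by (subst mat_diag_mult_right[of _ n]) auto
  then show ?thesis using M ij pw by (simp add: laplacian_def Let_def)
qed

definition adj :: "(nat \<times> nat \<Rightarrow> bool) \<Rightarrow> nat \<Rightarrow> nat \<Rightarrow> real" where
  "adj x i j = (if i < j then of_bool (x (i, j)) else if j < i then of_bool (x (j, i)) else 0)"

lemma regularize_adjacency:
  "regularize n \<tau> (adjacency_mat n x) \<in> carrier_mat n n"
  "i < n \<Longrightarrow> j < n \<Longrightarrow> regularize n \<tau> (adjacency_mat n x) $$ (i, j) = adj x i j + \<tau> / real n"
  by (auto simp: regularize_def adjacency_mat_def adj_def)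

lemma inhom_ER_eq:
  "inhom_ER n p = map_pmf (adjacency_mat n) (bernoulli_product (slots n) (\<lambda>e. p (fst e) (snd e)))"
  by (simp add: inhom_ER_def slots_def case_prod_unfold)

lemma expectation_edge:
  assumes "edge_probs n p" "i < j" "j < n"
  shows "measure_pmf.expectation (bernoulli_product (slots n) (\<lambda>e. p (fst e) (snd e)))
    (\<lambda>x. of_bool (x (i, j)) :: real) = p i j"
proof -
  let ?P = "bernoulli_product (slots n) (\<lambda>e. p (fst e) (snd e))"
  have e: "(i, j) \<in> slots n" using assms by (simp add: slots_def)
  have "measure_pmf.expectation ?P (\<lambda>x. of_bool (x (i, j)) :: real)
    = measure_pmf.expectation (map_pmf (\<lambda>x. x (i, j)) ?P) of_bool" by simp
  also have "map_pmf (\<lambda>x. x (i, j)) ?P = bernoulli_pmf (p i j)"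
    using e by (subst Pi_pmf_component) auto
  also have "measure_pmf.expectation (bernoulli_pmf (p i j)) of_bool = p i j"
    using assms by (simp add: edge_probs_def)
  finally show ?thesis .
qed

lemma expectation_regularized:
  assumes p: "edge_probs n p" and ij: "i < n" "j < n"
  shows "expectation_mat n (inhom_ER n p) (regularize n \<tau>) $$ (i, j) = p i j + \<tau> / real n"
proof -
  let ?P = "bernoulli_product (slots n) (\<lambda>e. p (fst e) (snd e))"
  have int: "integrable (measure_pmf ?P) f" for f :: "_ \<Rightarrow> real"
    by (intro integrable_measure_pmf_finite finite_set_bernoulli_product) simp
  have "expectation_mat n (inhom_ER n p) (regularize n \<tau>) $$ (i, j)
    = measure_pmf.expectation ?P (\<lambda>x. adj x i j + \<tau> / real n)"
    using ij by (simp add: expectation_mat_def inhom_ER_eq regularize_adjacency)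
  also have "\<dots> = measure_pmf.expectation ?P (\<lambda>x. adj x i j) + \<tau> / real n"
    by (subst Bochner_Integration.integral_add[OF int int]) simp
  also have "measure_pmf.expectation ?P (\<lambda>x. adj x i j) = p i j"
  proof -
    consider "i < j" | "j < i" | "i = j" by linarith
    then show ?thesis
    proof cases
      case 1
      then show ?thesis using expectation_edge[OF p, of i j] ij by (simp add: adj_def)
    next
      case 2
      then show ?thesis using expectation_edge[OF p, of j i] ij p by (simp add: adj_def edge_probs_def)
    next
      case 3
      then show ?thesis using ij p by (simp add: adj_def edge_probs_def)
    qed
  qed
  finally show ?thesis .
qed

text \<open>The identity matrices cancel, which leaves the normalized expected matrix minus the
  normalized random one. The difference is symmetric, so its quadratic form controls the spectral
  norm.\<close>

lemma laplacian_difference_norm_le: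
  assumes n: "1 \<le> n" and p: "edge_probs n p" and \<tau>: "0 < \<tau>" and c: "0 < c"
    and D: "\<And>i. D i = (\<Sum>j<n. adj x i j) + \<tau>" and E: "\<And>i. E i = (\<Sum>j<n. p i j) + \<tau>"
    and form: "\<And>y. \<bar>\<Sum>i<n. \<Sum>j<n. ((p i j + \<tau> / real n) / (sqrt (E i) * sqrt (E j))
        - (adj x i j + \<tau> / real n) / (sqrt (D i) * sqrt (D j))) * (y i * y j)\<bar> \<le> c * (\<Sum>i<n. (y i)\<^sup>2)"
  shows "spectral_norm (laplacian (regularize n \<tau> (adjacency_mat n x))
      - laplacian (expectation_mat n (inhom_ER n p) (regularize n \<tau>))) \<le> c"
proof -
  let ?A = "regularize n \<tau> (adjacency_mat n x)" and ?P = "expectation_mat n (inhom_ER n p) (regularize n \<tau>)"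
  have A: "?A \<in> carrier_mat n n" and P: "?P \<in> carrier_mat n n"
    by (simp_all add: regularize_adjacency expectation_mat_def)
  have adj: "0 \<le> adj x i j" "adj x i j = adj x j i" for i j by (auto simp: adj_def)
  have pp: "0 \<le> p i j" "p i j = p j i" if "i < n" "j < n" for i j using p that by (auto simp: edge_probs_def)
  have rows: "row_sum ?A i = D i" "row_sum ?P i = E i" "0 < D i" "0 < E i" if "i < n" for i
  proof -
    show "row_sum ?A i = D i"
      using that n by (simp add: row_sum_def carrier_matD(2)[OF A] regularize_adjacency sum.distrib D)
    show "row_sum ?P i = E i"
      using that n by (simp add: row_sum_def carrier_matD(2)[OF P] expectation_regularized[OF p] sum.distrib E)
    show "0 < D i" unfolding D using adj \<tau> by (intro add_nonneg_pos sum_nonneg) auto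
    show "0 < E i" unfolding E using pp that \<tau> by (intro add_nonneg_pos sum_nonneg) auto
  qed
  define N where "N i j = (p i j + \<tau> / real n) / (sqrt (E i) * sqrt (E j))
        - (adj x i j + \<tau> / real n) / (sqrt (D i) * sqrt (D j))" for i j
  have entry: "(laplacian ?A - laplacian ?P) $$ (i, j) = N i j" if "i < n" "j < n" for i j
    using that laplacian_carrier[OF A] laplacian_carrier[OF P]
      laplacian_entry[OF A rows(1) rows(3) that] laplacian_entry[OF P rows(2) rows(4) that]
    by (simp add: regularize_adjacency expectation_regularized[OF p] N_def)
  show ?thesis
  proof (rule spectral_norm_le)
    show "laplacian ?A - laplacian ?P \<in> carrier_mat n n"
      using laplacian_carrier[OF P] by (rule minus_carrier_mat)
    fix v :: "nat \<Rightarrow> real"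
    have "(\<Sum>i<n. (\<Sum>j<n. (laplacian ?A - laplacian ?P) $$ (i, j) * v j)\<^sup>2) = (\<Sum>i<n. (\<Sum>j<n. N i j * v j)\<^sup>2)"
      by (simp add: entry)
    also have "\<dots> \<le> c\<^sup>2 * (\<Sum>i<n. (v i)\<^sup>2)"
    proof (rule quadratic_form_norm_bound[OF _ c])
      show "N i j = N j i" if "i < n" "j < n" for i j
        using pp(2)[OF that] adj(2)[of i j] by (simp add: N_def mult.commute)
    qed (use form in \<open>simp add: N_def\<close>)
    finally show "(\<Sum>i<n. (\<Sum>j<n. (laplacian ?A - laplacian ?P) $$ (i, j) * v j)\<^sup>2) \<le> c\<^sup>2 * (\<Sum>i<n. (v i)\<^sup>2)" .
  qed (use c in simp)
qed

text \<open>Each of the two normalized matrices has quadratic form at most the squared norm,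
  whatever the graph.\<close>

lemma laplacian_difference_norm_le_2:
  assumes n: "1 \<le> n" and p: "edge_probs n p" and \<tau>: "0 < \<tau>"
  shows "spectral_norm (laplacian (regularize n \<tau> (adjacency_mat n x))
      - laplacian (expectation_mat n (inhom_ER n p) (regularize n \<tau>))) \<le> 2"
proof (rule laplacian_difference_norm_le[OF n p \<tau> _ refl refl])
  let ?D = "\<lambda>i. (\<Sum>j<n. adj x i j) + \<tau>" and ?E = "\<lambda>i. (\<Sum>j<n. p i j) + \<tau>"
  fix y :: "nat \<Rightarrow> real"
  have adj: "0 \<le> adj x i j" "adj x i j = adj x j i" for i j by (auto simp: adj_def)
  have pp: "0 \<le> p i j" "p i j = p j i" if "i < n" "j < n" for i j using p that by (auto simp: edge_probs_def)
  have "\<bar>\<Sum>i<n. \<Sum>j<n. (p i j + \<tau> / real n) / (sqrt (?E i) * sqrt (?E j)) * (y i * y j)\<bar> \<le> (\<Sum>i<n. (y i)\<^sup>2)"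
    using n pp \<tau> by (intro normalized_form_le) (auto simp: sum.distrib intro!: add_nonneg_pos sum_nonneg)
  moreover have "\<bar>\<Sum>i<n. \<Sum>j<n. (adj x i j + \<tau> / real n) / (sqrt (?D i) * sqrt (?D j)) * (y i * y j)\<bar> \<le> (\<Sum>i<n. (y i)\<^sup>2)"
    using n adj \<tau> by (intro normalized_form_le) (auto simp: sum.distrib intro!: add_nonneg_pos sum_nonneg)
  ultimately show "\<bar>\<Sum>i<n. \<Sum>j<n. ((p i j + \<tau> / real n) / (sqrt (?E i) * sqrt (?E j))
        - (adj x i j + \<tau> / real n) / (sqrt (?D i) * sqrt (?D j))) * (y i * y j)\<bar> \<le> 2 * (\<Sum>i<n. (y i)\<^sup>2)"
    unfolding left_diff_distrib sum_subtractf by linarith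
qed simp

lemma adj_slots: "e \<in> slots n \<Longrightarrow> adj x (fst e) (snd e) = of_bool (x e)"
  by (auto simp: slots_def adj_def)

theorem theorem2p1:
  shows "\<exists>C>(0::real). \<forall>(n :: nat) (p :: nat \<Rightarrow> nat \<Rightarrow> real) (\<tau> :: real) (r :: real).
    n \<ge> 1 \<longrightarrow> edge_probs n p \<longrightarrow> \<tau> > 0 \<longrightarrow> r \<ge> 1 \<longrightarrow>
    measure_pmf.prob (inhom_ER n p)
      {A. spectral_norm (laplacian (regularize n \<tau> A)
              - laplacian (expectation_mat n (inhom_ER n p) (regularize n \<tau>)))
          \<ge> C * (r ^ 2 / sqrt \<tau>) * (1 + max_density n p / \<tau>) powr (1 / 2)}
      \<le> exp (- r)"
proof (intro exI[of _ 600] conjI allI impI)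
  fix n :: nat and p :: "nat \<Rightarrow> nat \<Rightarrow> real" and \<tau> r :: real
  assume n: "1 \<le> n" and p: "edge_probs n p" and \<tau>: "0 < \<tau>" and r: "1 \<le> r"
  define d where "d = max_density n p"
  \<comment> \<open>With this \<open>K\<close> the threshold becomes
    \<open>600 * r^2 * sqrt K / \<tau>\<close>, and the regularized edge probabilities are at most
    \<open>K / n\<close>.\<close>
  define K where "K = \<tau> + d"
  define q where "q e = p (fst e) (snd e)" for e :: "nat \<times> nat"
  let ?P = "bernoulli_product (slots n) q"
  let ?\<Delta> = "\<lambda>x. spectral_norm (laplacian (regularize n \<tau> (adjacency_mat n x))
      - laplacian (expectation_mat n (inhom_ER n p) (regularize n \<tau>)))"
  have pd: "real n * p i j \<le> d" if "i < n" "j < n" for i j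
    unfolding d_def max_density_def using that
    by (intro Max_ge) (auto intro!: image_eqI[of _ _ "(i, j)"])
  have pp: "0 \<le> p i j" "p i j \<le> 1" "p i j = p j i" "p i i = 0" if "i < n" "j < n" for i j
    using p that by (auto simp: edge_probs_def)
  have d: "0 \<le> d" using pd[of 0 0] pp(4)[of 0 0] n by simp
  have K\<tau>: "\<tau> \<le> K" "0 < K" using d \<tau> by (auto simp: K_def)
  have "1 + d / \<tau> = K / \<tau>" using \<tau> by (simp add: K_def add_divide_distrib)
  then have target: "600 * (r ^ 2 / sqrt \<tau>) * (1 + max_density n p / \<tau>) powr (1 / 2) = 600 * r\<^sup>2 * sqrt K / \<tau>"
    using \<tau> K\<tau> by (simp add: d_def[symmetric] powr_half_sqrt real_sqrt_divide)
  have prob: "measure_pmf.prob (inhom_ER n p)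
      {A. spectral_norm (laplacian (regularize n \<tau> A)
              - laplacian (expectation_mat n (inhom_ER n p) (regularize n \<tau>)))
          \<ge> 600 * (r ^ 2 / sqrt \<tau>) * (1 + max_density n p / \<tau>) powr (1 / 2)}
    = measure_pmf.prob ?P {x. 600 * r\<^sup>2 * sqrt K / \<tau> \<le> ?\<Delta> x}"
    unfolding target inhom_ER_eq q_def[abs_def] by (simp add: vimage_def)
  show "measure_pmf.prob (inhom_ER n p)
      {A. spectral_norm (laplacian (regularize n \<tau> A)
              - laplacian (expectation_mat n (inhom_ER n p) (regularize n \<tau>)))
          \<ge> 600 * (r ^ 2 / sqrt \<tau>) * (1 + max_density n p / \<tau>) powr (1 / 2)} \<le> exp (- r)"
    unfolding prob
  proof (cases "1 \<le> \<tau>")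
    case False
    \<comment> \<open>Since \<open>\<tau> \<le> sqrt \<tau> \<le> sqrt K\<close>, the threshold is
      at least 600, while the norm is at most 2.\<close>
    have "?\<Delta> x < 600 * r\<^sup>2 * sqrt K / \<tau>" for x
    proof -
      have "\<tau> \<le> sqrt \<tau>" using False \<tau> by (intro real_le_rsqrt) (simp add: power2_eq_square mult_left_le)
      also have "\<dots> \<le> sqrt K" using K\<tau> by simp
      finally have "1 \<le> sqrt K / \<tau>" using \<tau> by simp
      moreover have "1 \<le> r\<^sup>2" using r by (rule one_le_power)
      ultimately have "1 * 1 \<le> r\<^sup>2 * (sqrt K / \<tau>)" by (intro mult_mono) auto
      then show ?thesis using laplacian_difference_norm_le_2[OF n p \<tau>, of x] by simp
    qed
    then have "{x. 600 * r\<^sup>2 * sqrt K / \<tau> \<le> ?\<Delta> x} = {}" by (auto simp: not_le)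
    then show "measure_pmf.prob ?P {x. 600 * r\<^sup>2 * sqrt K / \<tau> \<le> ?\<Delta> x} \<le> exp (- r)" by simp
  next
    case True
    define E where "E i = (\<Sum>j<n. p i j) + \<tau>" for i
    have q: "0 \<le> q e \<and> q e \<le> 1" "q e \<le> K / real n" if "e \<in> slots n" for e
    proof -
      have e: "fst e < n" "snd e < n" using that by (auto simp: slots_def)
      show "0 \<le> q e \<and> q e \<le> 1" using pp[OF e] by (simp add: q_def)
      show "q e \<le> K / real n" using pd[OF e] n \<tau> by (simp add: q_def K_def field_simps)
    qed
    have Esum: "(\<Sum>e\<in>slots n. if fst e = i \<or> snd e = i then q e else 0) = E i - \<tau>" if "i < n" for i
      using sum_neighbours_slots[of n p i] pp(3) pp(4)[OF that that] that unfolding E_def q_def by simp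
    \<comment> \<open>One use of \<open>\<tau> \<ge> 1\<close>: it keeps the tilts
      \<open>1 / sqrt (E i)\<close> of the degree deviations at most 1.\<close>
    have E1: "1 \<le> E i" if "i < n" for i
      using True pp that unfolding E_def by (intro add_increasing sum_nonneg) auto
    \<comment> \<open>Both events are taken with \<open>R = r + 3\<close>: together they have
      probability at most \<open>5 * exp (- (r + 3))\<close>, and
      \<open>5 \<le> exp 3\<close>.\<close>
    define F where "F = {x. \<not> (\<forall>z. \<bar>slot_form n (\<lambda>e. of_bool (x e) - q e) z\<bar>
      \<le> sqrt K * (211 + 10 * (r + 3)) * (\<Sum>i<n. (z i)\<^sup>2)
        + 4 / sqrt K * edge_energy n (\<lambda>e. of_bool (x e)) z)}"
    define G where "G = {x. \<not> (\<Sum>i<n. (degree_dev n q x i)\<^sup>2 / E i) \<le> 10 * real n * (r + 3 + 1)\<^sup>2}"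
    have "{x. 600 * r\<^sup>2 * sqrt K / \<tau> \<le> ?\<Delta> x} \<subseteq> F \<union> G"
    proof (rule subsetI, rule ccontr)
      fix x assume x: "x \<in> {x. 600 * r\<^sup>2 * sqrt K / \<tau> \<le> ?\<Delta> x}" and "x \<notin> F \<union> G"
      then have form: "\<And>z. \<bar>slot_form n (\<lambda>e. of_bool (x e) - q e) z\<bar>
          \<le> sqrt K * (211 + 10 * (r + 3)) * (\<Sum>i<n. (z i)\<^sup>2)
            + 4 / sqrt K * edge_energy n (\<lambda>e. of_bool (x e)) z"
        and deg: "(\<Sum>i<n. (degree_dev n q x i)\<^sup>2 / E i) \<le> 10 * real n * (r + 3 + 1)\<^sup>2"
        by (auto simp: F_def G_def)
      have dev: "degree_dev n q x i = ((\<Sum>j<n. adj x i j) + \<tau>) - E i" if "i < n" for i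
      proof -
        have "(\<Sum>j<n. adj x i j) = (\<Sum>e\<in>slots n. if fst e = i \<or> snd e = i then of_bool (x e) else 0)"
          using that by (subst sum_neighbours_slots) (auto simp: adj_def slots_def intro!: sum.cong)
        then have "((\<Sum>j<n. adj x i j) + \<tau>) - E i
            = (\<Sum>e\<in>slots n. if fst e = i \<or> snd e = i then of_bool (x e) else 0)
              - (\<Sum>e\<in>slots n. if fst e = i \<or> snd e = i then q e else 0)"
          using Esum[OF that] by simp
        then show ?thesis
          unfolding degree_dev_def sum_subtractf[symmetric] by (auto intro!: sum.cong)
      qed
      have slot: "slot_form n (\<lambda>e. adj x (fst e) (snd e) - p (fst e) (snd e)) z
          = slot_form n (\<lambda>e. of_bool (x e) - q e) z"
        "edge_energy n (\<lambda>e. adj x (fst e) (snd e)) z = edge_energy n (\<lambda>e. of_bool (x e)) z" for z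
        unfolding slot_form_def edge_energy_def using adj_slots[of _ n x]
        by (auto intro!: sum.cong simp: q_def)
      have "?\<Delta> x \<le> 545 * r * sqrt K / \<tau>"
      proof (rule laplacian_difference_norm_le[OF n p \<tau> _ refl E_def])
        show "0 < 545 * r * sqrt K / \<tau>" using r K\<tau> \<tau> by simp
        fix y :: "nat \<Rightarrow> real"
        show "\<bar>\<Sum>i<n. \<Sum>j<n. ((p i j + \<tau> / real n) / (sqrt (E i) * sqrt (E j))
          - (adj x i j + \<tau> / real n) / (sqrt ((\<Sum>j<n. adj x i j) + \<tau>) * sqrt ((\<Sum>k<n. adj x j k) + \<tau>)))
            * (y i * y j)\<bar> \<le> 545 * r * sqrt K / \<tau> * (\<Sum>i<n. (y i)\<^sup>2)"
        proof (rule normalized_difference_form_bound[OF n r True K\<tau>(1), where D = "\<lambda>i. (\<Sum>j<n. adj x i j) + \<tau>" and E = E])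
          show "p i j + \<tau> / real n \<le> K / real n" if "i < n" "j < n" for i j
            using pd[OF that] n by (simp add: K_def field_simps)
          show "(\<Sum>i<n. ((\<Sum>j<n. adj x i j) + \<tau> - E i)\<^sup>2 / E i) \<le> 10 * real n * (r + 3 + 1)\<^sup>2"
            using deg by (simp add: dev)
          show "\<bar>slot_form n (\<lambda>e. adj x (fst e) (snd e) - p (fst e) (snd e)) z\<bar>
            \<le> sqrt K * (211 + 10 * (r + 3)) * (\<Sum>i<n. (z i)\<^sup>2)
              + 4 / sqrt K * edge_energy n (\<lambda>e. adj x (fst e) (snd e)) z" for z
            unfolding slot by (rule form)
        qed (use pp in \<open>auto simp: adj_def E_def\<close>)
      qed
      \<comment> \<open>The event in the theorem contains equality, so the bound must be strict; 600
        leaves room above 545.\<close>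
      also have "\<dots> < 600 * r\<^sup>2 * sqrt K / \<tau>"
      proof -
        have "r \<le> r\<^sup>2" using r by (simp add: power2_eq_square)
        then have "545 * r < 600 * r\<^sup>2" using r by linarith
        then have "545 * r * (sqrt K / \<tau>) < 600 * r\<^sup>2 * (sqrt K / \<tau>)"
          using K\<tau> \<tau> by (intro mult_strict_right_mono) auto
        then show ?thesis by simp
      qed
      finally show False using x by simp
    qed
    then have "measure_pmf.prob ?P {x. 600 * r\<^sup>2 * sqrt K / \<tau> \<le> ?\<Delta> x} \<le> measure_pmf.prob ?P (F \<union> G)"
      by (intro measure_pmf.finite_measure_mono) auto
    also have "\<dots> \<le> measure_pmf.prob ?P F + measure_pmf.prob ?P G"
      by (rule measure_Un_le) auto
    also have "\<dots> \<le> 4 * exp (- (r + 3)) + exp (- (r + 3))"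
    proof (rule add_mono)
      show "measure_pmf.prob ?P F \<le> 4 * exp (- (r + 3))"
        unfolding F_def using r True K\<tau> by (intro form_event n q) auto
      show "measure_pmf.prob ?P G \<le> exp (- (r + 3))"
        unfolding G_def using r Esum \<tau> by (intro degree_event n q E1) auto
    qed
    also have "\<dots> = 5 * exp (- 3) * exp (- r)" by (simp add: exp_add exp_diff exp_minus divide_inverse)
    also have "\<dots> \<le> 1 * exp (- r)"
    proof (rule mult_right_mono)
      have "5 \<le> exp (3::real)" using exp_lower_Taylor_quadratic[of "3::real"] by (simp add: power2_eq_square)
      then show "5 * exp (- 3) \<le> (1::real)" by (simp add: exp_minus divide_simps)
    qed simp
    finally show "measure_pmf.prob ?P {x. 600 * r\<^sup>2 * sqrt K / \<tau> \<le> ?\<Delta> x} \<le> exp (- r)" by simp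
  qed
qed simp

end
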